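(* Let $N\ge2$, let $\Omega\subset\mathbb R^N$ be a bounded strictly convex domain and let $f$ be a continuous and bounded function in $\Omega$. Then there exists a solution $u\in C(\overline\Omega)$ of $$\mathcal P_1^+(D^2u)+\mu u=f\ \text{ in }\Omega,\qquad u=0\ \text{ on }\partial\Omega,$$ in the following two cases: (a) for $\mu<\mu_1^+$; (b) for any $\mu\in\mathbb R$, if $f\ge0$. Moreover, in the case $\mu<\mu_1^+$ the solution is unique.
   Context: $\mathcal P_1^+(X)=\lambda_N(X)$ is the largest eigenvalue of the symmetric $N\times N$ matrix $X$. A domain is a nonempty open connected set; $\Omega$ is strictly convex if $(1-t)x+ty\in\Omega$ for all $x\neq y$ in $\overline\Omega$ and $0<t<1$. $\mathrm{LSC}(\Omega)$ is the set of real-valued lower semicontinuous functions on $\Omega$. Define $$\mu_1^+=\sup\{\mu\in\mathbb R:\exists\,\varphi\in\mathrm{LSC}(\Omega),\ \varphi>0,\ \mathcal P_1^+(D^2\varphi)+\mu\varphi\le0\ \text{in }\Omega\}.$$ All equations and inequalities are in the viscosity sense: $u$ upper (resp. lower) semicontinuous satisfies $\mathcal P_1^+(D^2u)+\mu u\ge f$ (resp. $\le f$) if whenever $\varphi$ is $C^2$ near $x_0\in\Omega$ and $u-\varphi$ has a local maximum (resp. minimum) at $x_0$, then $\mathcal P_1^+(D^2\varphi(x_0))+\mu u(x_0)\ge f(x_0)$ (resp. $\le f(x_0)$); a solution is a continuous function satisfying both. The boundary condition is pointwise. *)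

theory Defs
  imports "HOL-Analysis.Analysis"
begin

definition strictly_convex :: "'a::real_normed_vector set \<Rightarrow> bool" where
  "strictly_convex S \<longleftrightarrow>
     (\<forall>x\<in>closure S. \<forall>y\<in>closure S. x \<noteq> y \<longrightarrow>
        (\<forall>t. 0 < t \<and> t < 1 \<longrightarrow> (1 - t) *\<^sub>R x + t *\<^sub>R y \<in> S))"

definition lsc_on :: "'a::topological_space set \<Rightarrow> ('a \<Rightarrow> real) \<Rightarrow> bool" where
  "lsc_on S u \<longleftrightarrow> (\<forall>x\<in>S. \<forall>a<u x. \<forall>\<^sub>F y in at x within S. a < u y)"

definition usc_on :: "'a::topological_space set \<Rightarrow> ('a \<Rightarrow> real) \<Rightarrow> bool" where
  "usc_on S u \<longleftrightarrow> (\<forall>x\<in>S. \<forall>a>u x. \<forall>\<^sub>F y in at x within S. u y < a)"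

definition eigenvalues :: "real^'n^'n \<Rightarrow> real set" where
  "eigenvalues X = {c. \<exists>v. v \<noteq> 0 \<and> X *v v = c *\<^sub>R v}"

text \<open>
  The operator \<open>\<P>\<^sub>1\<^sup>+\<close>: the largest eigenvalue. It is meant for symmetric \<open>X\<close> only, for which
  the set of eigenvalues is finite and nonempty; it is only applied to Hessians of
  \<open>C\<^sup>2\<close> functions, and these are symmetric.
\<close>
definition P1_plus :: "real^'n^'n \<Rightarrow> real" where
  "P1_plus X = Max (eigenvalues X)"

text \<open>\<open>\<phi>\<close> is \<open>C\<^sup>2\<close> near \<open>x\<^sub>0\<close>, with gradient \<open>G\<close> and Hessian \<open>H\<close> there.\<close>
definition C2_near ::
  "real^'n \<Rightarrow> (real^'n \<Rightarrow> real) \<Rightarrow> (real^'n \<Rightarrow> real^'n) \<Rightarrow> (real^'n \<Rightarrow> real^'n^'n) \<Rightarrow> bool" where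
  "C2_near x\<^sub>0 \<phi> G H \<longleftrightarrow>
     (\<exists>U. open U \<and> x\<^sub>0 \<in> U \<and> continuous_on U H \<and>
        (\<forall>x\<in>U. GDERIV \<phi> x :> G x \<and> (G has_derivative (\<lambda>h. H x *v h)) (at x)))"

text \<open>\<open>\<P>\<^sub>1\<^sup>+(D\<^sup>2u) + \<mu>u \<ge> f\<close>, respectively \<open>\<le> f\<close>, in \<open>\<Omega>\<close> in the viscosity sense.\<close>
definition visc_subsol ::
  "(real^'n) set \<Rightarrow> real \<Rightarrow> (real^'n \<Rightarrow> real) \<Rightarrow> (real^'n \<Rightarrow> real) \<Rightarrow> bool" where
  "visc_subsol \<Omega> \<mu> f u \<longleftrightarrow> usc_on \<Omega> u \<and>
     (\<forall>x\<^sub>0\<in>\<Omega>. \<forall>\<phi> G H. C2_near x\<^sub>0 \<phi> G H \<and>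
        (\<forall>\<^sub>F x in at x\<^sub>0 within \<Omega>. u x - \<phi> x \<le> u x\<^sub>0 - \<phi> x\<^sub>0) \<longrightarrow>
        P1_plus (H x\<^sub>0) + \<mu> * u x\<^sub>0 \<ge> f x\<^sub>0)"

definition visc_supersol ::
  "(real^'n) set \<Rightarrow> real \<Rightarrow> (real^'n \<Rightarrow> real) \<Rightarrow> (real^'n \<Rightarrow> real) \<Rightarrow> bool" where
  "visc_supersol \<Omega> \<mu> f u \<longleftrightarrow> lsc_on \<Omega> u \<and>
     (\<forall>x\<^sub>0\<in>\<Omega>. \<forall>\<phi> G H. C2_near x\<^sub>0 \<phi> G H \<and>
        (\<forall>\<^sub>F x in at x\<^sub>0 within \<Omega>. u x - \<phi> x \<ge> u x\<^sub>0 - \<phi> x\<^sub>0) \<longrightarrow>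
        P1_plus (H x\<^sub>0) + \<mu> * u x\<^sub>0 \<le> f x\<^sub>0)"

definition visc_sol ::
  "(real^'n) set \<Rightarrow> real \<Rightarrow> (real^'n \<Rightarrow> real) \<Rightarrow> (real^'n \<Rightarrow> real) \<Rightarrow> bool" where
  "visc_sol \<Omega> \<mu> f u \<longleftrightarrow>
     continuous_on \<Omega> u \<and> visc_subsol \<Omega> \<mu> f u \<and> visc_supersol \<Omega> \<mu> f u"

definition dirichlet_sol ::
  "(real^'n) set \<Rightarrow> real \<Rightarrow> (real^'n \<Rightarrow> real) \<Rightarrow> (real^'n \<Rightarrow> real) \<Rightarrow> bool" where
  "dirichlet_sol \<Omega> \<mu> f u \<longleftrightarrow>
     continuous_on (closure \<Omega>) u \<and> visc_sol \<Omega> \<mu> f u \<and> (\<forall>x\<in>frontier \<Omega>. u x = 0)"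

text \<open>
  The supremum is taken in the extended reals, so that no separate boundedness
  argument is needed for it to have its usual meaning.
\<close>
definition mu1_plus :: "(real^'n) set \<Rightarrow> ereal" where
  "mu1_plus \<Omega> = Sup (ereal ` {\<mu>. \<exists>\<phi>. (\<forall>x\<in>\<Omega>. \<phi> x > 0) \<and> visc_supersol \<Omega> \<mu> (\<lambda>_. 0) \<phi>})"

end

theory Submission
  imports Defs
begin

text \<open>
  \<open>\<P>\<^sub>1\<^sup>+(D\<^sup>2v) \<le> c\<close> says that every second directional derivative of \<open>v\<close> is at most \<open>c\<close>, so a
  supersolution minus a multiple of \<open>\<bar>x\<bar>\<^sup>2 / 2\<close> is locally concave. Its supergradient gives, for every
  \<open>c > f(x\<^sub>0) - \<mu>v(x\<^sub>0)\<close>, a paraboloid with Hessian \<open>c I\<close> touching \<open>v\<close> from above at \<open>x\<^sub>0\<close>, and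
  this is an admissible test function for a subsolution that \<open>v\<close> touches from above. Hence the
  comparison principle needs no doubling of variables: one takes the maximum of \<open>(u - v) / \<phi>\<close>
  for a strict supersolution \<open>\<phi>\<close>, made positive up to the boundary by a homothety of \<open>\<Omega>\<close>.

  Existence is Perron's method from above: the infimum of supersolutions is again semiconcave,
  hence continuous, so that neither semicontinuous envelopes nor a comparison principle are
  needed, and arbitrary \<open>\<mu>\<close> is allowed. It only requires a subsolution below and supersolutions
  above that attain the boundary values. Below, \<open>-A exp(-k\<bar>x\<bar>\<^sup>2/2)\<close> is a subsolution because of its
  second derivative in a direction orthogonal to \<open>x\<close>; this is where \<open>N \<ge> 2\<close> enters. Above, the
  constant \<open>0\<close> serves if \<open>f \<ge> 0\<close>; otherwise multiples of \<open>\<phi>\<close> are cut off by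
  concave paraboloids, nonnegative on \<open>\<Omega>\<close> and small at a boundary point by strict convexity.
\<close>

section \<open>Second-order expansions and the largest eigenvalue\<close>

definition self_adjoint :: "('a::real_inner \<Rightarrow> 'a) \<Rightarrow> bool" where
  "self_adjoint L \<longleftrightarrow> linear L \<and> (\<forall>u v. u \<bullet> L v = v \<bullet> L u)"

text \<open>The mean value theorem along the segment from \<open>x0\<close> to \<open>x\<close>,
  applied to \<phi> minus its quadratic polynomial, reduces the error to that of the first-order
  expansion of \<open>G\<close> at \<open>x0\<close>.\<close>

lemma taylor_gradient:
  fixes \<phi> :: "'a::real_inner \<Rightarrow> real"
  assumes ev: "\<forall>\<^sub>F x in nhds x0. GDERIV \<phi> x :> G x"
    and G: "(G has_derivative L) (at x0)" and "\<eta> > 0"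
  shows "\<forall>\<^sub>F x in nhds x0.
    \<bar>\<phi> x - \<phi> x0 - G x0 \<bullet> (x - x0) - (x - x0) \<bullet> L (x - x0) / 2\<bar> \<le> \<eta> * ((x - x0) \<bullet> (x - x0))"
proof -
  obtain d1 where d1: "d1 > 0" "\<And>x. dist x x0 < d1 \<Longrightarrow> GDERIV \<phi> x :> G x"
    using ev unfolding eventually_nhds_metric by blast
  obtain d2 where d2: "d2 > 0"
    "\<And>x. norm (x - x0) < d2 \<Longrightarrow> norm (G x - G x0 - L (x - x0)) \<le> \<eta> * norm (x - x0)"
    using G \<open>\<eta> > 0\<close> unfolding has_derivative_at_alt by blast
  have lin: "linear L" using G has_derivative_linear by blast
  define d where "d = min d1 d2"
  have "d > 0" using d1 d2 by (simp add: d_def)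
  have "\<bar>\<phi> x - \<phi> x0 - G x0 \<bullet> (x - x0) - (x - x0) \<bullet> L (x - x0) / 2\<bar> \<le> \<eta> * ((x - x0) \<bullet> (x - x0))"
    if x: "dist x x0 < d" for x
  proof -
    define y where "y = x - x0"
    have y: "norm y < d" using x by (simp add: y_def dist_norm)
    define k where "k = (\<lambda>s. \<phi> (x0 + s *\<^sub>R y) - s * (G x0 \<bullet> y) - s^2 / 2 * (y \<bullet> L y))"
    define k' where "k' = (\<lambda>s. y \<bullet> G (x0 + s *\<^sub>R y) - G x0 \<bullet> y - s * (y \<bullet> L y))"
    have small: "norm (s *\<^sub>R y) < d" if "0 \<le> s" "s \<le> 1" for s
    proof -
      have "s * norm y \<le> 1 * norm y" using that by (intro mult_right_mono) auto
      thus ?thesis using y that by simp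
    qed
    have der: "(k has_real_derivative k' s) (at s)" if "0 \<le> s" "s \<le> 1" for s
    proof -
      have "GDERIV \<phi> (x0 + s *\<^sub>R y) :> G (x0 + s *\<^sub>R y)"
        using small[OF that] by (intro d1) (simp add: dist_norm d_def)
      hence "(\<phi> has_derivative (\<lambda>h. h \<bullet> G (x0 + s *\<^sub>R y))) (at (x0 + s *\<^sub>R y))"
        by (simp add: gderiv_def)
      moreover have "((\<lambda>s. x0 + s *\<^sub>R y) has_derivative (\<lambda>h. h *\<^sub>R y)) (at s)"
        by (auto intro!: derivative_eq_intros)
      ultimately have "((\<lambda>s. \<phi> (x0 + s *\<^sub>R y)) has_derivative (\<lambda>h. (h *\<^sub>R y) \<bullet> G (x0 + s *\<^sub>R y))) (at s)"
        using has_derivative_compose by blast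
      hence "((\<lambda>s. \<phi> (x0 + s *\<^sub>R y)) has_real_derivative (y \<bullet> G (x0 + s *\<^sub>R y))) (at s)"
        by (simp add: has_field_derivative_def mult_commute_abs)
      thus ?thesis unfolding k_def k'_def
        by (auto intro!: derivative_eq_intros)
    qed
    obtain \<xi> where \<xi>: "0 < \<xi>" "\<xi> < 1" "k 1 - k 0 = (1 - 0) * k' \<xi>"
      using MVT2[of 0 1 k k'] der by auto
    have "norm (\<xi> *\<^sub>R y) < d2" using small[of \<xi>] \<xi> by (simp add: d_def)
    hence "norm (G (x0 + \<xi> *\<^sub>R y) - G x0 - L (\<xi> *\<^sub>R y)) \<le> \<eta> * norm (\<xi> *\<^sub>R y)"
      using d2(2)[of "x0 + \<xi> *\<^sub>R y"] by simp
    also have "\<dots> \<le> \<eta> * norm y"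
    proof -
      have "\<xi> * norm y \<le> 1 * norm y" using \<xi> by (intro mult_right_mono) auto
      thus ?thesis using \<xi> \<open>\<eta> > 0\<close> by simp
    qed
    finally have b: "norm (G (x0 + \<xi> *\<^sub>R y) - G x0 - L (\<xi> *\<^sub>R y)) \<le> \<eta> * norm y" .
    have "k' \<xi> = y \<bullet> (G (x0 + \<xi> *\<^sub>R y) - G x0 - L (\<xi> *\<^sub>R y))"
      unfolding k'_def by (simp add: linear_scale[OF lin] inner_diff_right inner_commute[of "G x0"])
    hence "\<bar>k' \<xi>\<bar> \<le> norm y * norm (G (x0 + \<xi> *\<^sub>R y) - G x0 - L (\<xi> *\<^sub>R y))"
      by (simp add: Cauchy_Schwarz_ineq2)
    also have "\<dots> \<le> norm y * (\<eta> * norm y)"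
      using b by (intro mult_left_mono) auto
    also have "\<dots> = \<eta> * (y \<bullet> y)" by (simp add: dot_square_norm power2_eq_square)
    finally have "\<bar>k 1 - k 0\<bar> \<le> \<eta> * (y \<bullet> y)" using \<xi> by simp
    moreover have "k 1 - k 0 = \<phi> x - \<phi> x0 - G x0 \<bullet> y - y \<bullet> L y / 2"
    proof -
      have "x0 + y = x" by (simp add: y_def)
      thus ?thesis by (simp add: k_def)
    qed
    ultimately show ?thesis by (simp add: y_def)
  qed
  thus ?thesis using \<open>d > 0\<close> unfolding eventually_nhds_metric by blast
qed

text \<open>The mean value theorem in the direction \<open>u\<close> turns the mixed second
  difference into \<open>t\<close> times the difference of \<open>u \<bullet> G\<close> at two
  points \<open>t *\<^sub>R v\<close> apart; expanding \<open>G\<close> about \<open>x0\<close> at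
  both leaves \<open>t * (u \<bullet> L v)\<close> for that difference.\<close>

lemma young_difference_quotient:
  fixes \<phi> :: "'a::real_inner \<Rightarrow> real"
  assumes ev: "\<forall>\<^sub>F x in nhds x0. GDERIV \<phi> x :> G x"
    and G: "(G has_derivative L) (at x0)"
  shows "((\<lambda>t. (\<phi> (x0 + t *\<^sub>R u + t *\<^sub>R v) - \<phi> (x0 + t *\<^sub>R u) - \<phi> (x0 + t *\<^sub>R v) + \<phi> x0) / t\<^sup>2)
    \<longlongrightarrow> u \<bullet> L v) (at_right 0)"
proof (rule tendstoI)
  fix \<epsilon> :: real assume "\<epsilon> > 0"
  have lin: "linear L" using G has_derivative_linear by blast
  define B where "B = norm u + norm v + 1"
  have B: "B > 0" "norm u < B" by (auto simp: B_def intro: add_nonneg_pos add_pos_nonneg)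
  \<comment> \<open>Two expansion errors of at most \<open>\<eta> * (t * B)\<close> each, paired
    with \<open>u\<close>, cost at most \<open>t * (\<epsilon> / 2)\<close>.\<close>
  define \<eta> where "\<eta> = \<epsilon> / (4 * B * B)"
  have "\<eta> > 0" using \<open>\<epsilon> > 0\<close> B by (simp add: \<eta>_def)
  obtain d1 where d1: "d1 > 0" "\<And>x. dist x x0 < d1 \<Longrightarrow> GDERIV \<phi> x :> G x"
    using ev unfolding eventually_nhds_metric by blast
  obtain d2 where d2: "d2 > 0"
    "\<And>x. norm (x - x0) < d2 \<Longrightarrow> norm (G x - G x0 - L (x - x0)) \<le> \<eta> * norm (x - x0)"
    using G \<open>\<eta> > 0\<close> unfolding has_derivative_at_alt by blast
  define d where "d = min d1 d2 / B"
  have "d > 0" using d1 d2 B by (simp add: d_def)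
  have main: "dist ((\<phi> (x0 + t *\<^sub>R u + t *\<^sub>R v) - \<phi> (x0 + t *\<^sub>R u) - \<phi> (x0 + t *\<^sub>R v) + \<phi> x0) / t\<^sup>2) (u \<bullet> L v) < \<epsilon>"
    if t: "0 < t" "t < d" for t
  proof -
    have tB: "t * B < d1" "t * B < d2"
      using t B by (auto simp: d_def pos_less_divide_eq)
    have nb: "norm (s *\<^sub>R u + r *\<^sub>R v) \<le> t * B" if "0 \<le> s" "s \<le> t" "0 \<le> r" "r \<le> t" for s r
    proof -
      have "norm (s *\<^sub>R u + r *\<^sub>R v) \<le> s * norm u + r * norm v"
        using that norm_triangle_ineq[of "s *\<^sub>R u" "r *\<^sub>R v"] by simp
      also have "\<dots> \<le> t * norm u + t * norm v" using that by (intro add_mono mult_right_mono) auto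
      also have "\<dots> \<le> t * B" using t by (simp add: B_def algebra_simps)
      finally show ?thesis .
    qed
    define k where "k = (\<lambda>s. \<phi> (x0 + s *\<^sub>R u + t *\<^sub>R v) - \<phi> (x0 + s *\<^sub>R u + 0 *\<^sub>R v))"
    define k' where "k' = (\<lambda>s. u \<bullet> G (x0 + s *\<^sub>R u + t *\<^sub>R v) - u \<bullet> G (x0 + s *\<^sub>R u + 0 *\<^sub>R v))"
    have der1: "((\<lambda>s. \<phi> (x0 + s *\<^sub>R u + r *\<^sub>R v)) has_real_derivative u \<bullet> G (x0 + s *\<^sub>R u + r *\<^sub>R v)) (at s)"
      if "0 \<le> s" "s \<le> t" "0 \<le> r" "r \<le> t" for s r
    proof -
      have "GDERIV \<phi> (x0 + s *\<^sub>R u + r *\<^sub>R v) :> G (x0 + s *\<^sub>R u + r *\<^sub>R v)"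
        using nb[OF that] tB by (intro d1) (simp add: dist_norm add.assoc)
      hence "(\<phi> has_derivative (\<lambda>h. h \<bullet> G (x0 + s *\<^sub>R u + r *\<^sub>R v))) (at (x0 + s *\<^sub>R u + r *\<^sub>R v))"
        by (simp add: gderiv_def)
      moreover have "((\<lambda>s. x0 + s *\<^sub>R u + r *\<^sub>R v) has_derivative (\<lambda>h. h *\<^sub>R u)) (at s)"
        by (auto intro!: derivative_eq_intros)
      ultimately have "((\<lambda>s. \<phi> (x0 + s *\<^sub>R u + r *\<^sub>R v)) has_derivative (\<lambda>h. (h *\<^sub>R u) \<bullet> G (x0 + s *\<^sub>R u + r *\<^sub>R v))) (at s)"
        using has_derivative_compose by blast
      thus ?thesis
        by (simp add: has_field_derivative_def mult_commute_abs)
    qed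
    have "(k has_real_derivative k' s) (at s)" if "0 \<le> s" "s \<le> t" for s
      unfolding k_def k'_def using that t by (intro DERIV_diff der1) auto
    then obtain \<xi> where \<xi>: "0 < \<xi>" "\<xi> < t" "k t - k 0 = (t - 0) * k' \<xi>"
      using MVT2[of 0 t k k'] t by auto
    have est: "norm (G (x0 + \<xi> *\<^sub>R u + r *\<^sub>R v) - G x0 - L (\<xi> *\<^sub>R u + r *\<^sub>R v)) \<le> \<eta> * (t * B)"
      if "0 \<le> r" "r \<le> t" for r
    proof -
      have n: "norm (\<xi> *\<^sub>R u + r *\<^sub>R v) \<le> t * B" using \<xi> that by (intro nb) auto
      have "norm (G (x0 + (\<xi> *\<^sub>R u + r *\<^sub>R v)) - G x0 - L (\<xi> *\<^sub>R u + r *\<^sub>R v)) \<le> \<eta> * norm (\<xi> *\<^sub>R u + r *\<^sub>R v)"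
        using d2(2)[of "x0 + (\<xi> *\<^sub>R u + r *\<^sub>R v)"] n tB by simp
      also have "\<dots> \<le> \<eta> * (t * B)" using n \<open>\<eta> > 0\<close> by (intro mult_left_mono) auto
      finally show ?thesis by (simp add: add.assoc)
    qed
    define E where "E = (\<lambda>r. G (x0 + \<xi> *\<^sub>R u + r *\<^sub>R v) - G x0 - L (\<xi> *\<^sub>R u + r *\<^sub>R v))"
    have "k' \<xi> - t * (u \<bullet> L v) = u \<bullet> (E t - E 0)"
      unfolding k'_def E_def
      by (simp add: linear_add[OF lin] linear_scale[OF lin] linear_0[OF lin] inner_diff_right inner_add_right)
    hence "\<bar>k' \<xi> - t * (u \<bullet> L v)\<bar> \<le> norm u * norm (E t - E 0)"
      by (simp add: Cauchy_Schwarz_ineq2)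
    also have "\<dots> \<le> B * (2 * (\<eta> * (t * B)))"
    proof (intro mult_mono)
      show "norm (E t - E 0) \<le> 2 * (\<eta> * (t * B))"
        using norm_triangle_ineq4[of "E t" "E 0"] est[of t] est[of 0] t unfolding E_def by simp
    qed (use B in auto)
    also have "\<dots> = t * (\<epsilon> / 2)" using B by (simp add: \<eta>_def field_simps)
    finally have a: "\<bar>k' \<xi> - t * (u \<bullet> L v)\<bar> \<le> t * (\<epsilon> / 2)" .
    have "\<phi> (x0 + t *\<^sub>R u + t *\<^sub>R v) - \<phi> (x0 + t *\<^sub>R u) - \<phi> (x0 + t *\<^sub>R v) + \<phi> x0 = t * k' \<xi>"
      using \<xi>(3) by (simp add: k_def)
    hence "(\<phi> (x0 + t *\<^sub>R u + t *\<^sub>R v) - \<phi> (x0 + t *\<^sub>R u) - \<phi> (x0 + t *\<^sub>R v) + \<phi> x0) / t\<^sup>2 = k' \<xi> / t"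
      using t by (simp add: power2_eq_square)
    moreover have "\<bar>k' \<xi> / t - u \<bullet> L v\<bar> = \<bar>k' \<xi> - t * (u \<bullet> L v)\<bar> / t"
    proof -
      have "k' \<xi> / t - u \<bullet> L v = (k' \<xi> - t * (u \<bullet> L v)) / t"
        using t by (simp add: diff_divide_distrib)
      thus ?thesis using t by (simp add: abs_divide)
    qed
    moreover have "\<bar>k' \<xi> - t * (u \<bullet> L v)\<bar> / t \<le> \<epsilon> / 2" using a t by (simp add: field_simps)
    moreover have "\<epsilon> / 2 < \<epsilon>" using \<open>\<epsilon> > 0\<close> by simp
    ultimately show ?thesis unfolding dist_real_def by (metis order_le_less_trans)
  qed
  show "\<forall>\<^sub>F t in at_right 0. dist ((\<phi> (x0 + t *\<^sub>R u + t *\<^sub>R v) - \<phi> (x0 + t *\<^sub>R u) - \<phi> (x0 + t *\<^sub>R v) + \<phi> x0) / t\<^sup>2) (u \<bullet> L v) < \<epsilon>"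
    unfolding eventually_at_right_field using main \<open>d > 0\<close> by blast
qed

text \<open>The mixed second difference is unchanged when \<open>u\<close> and \<open>v\<close> are
  exchanged, so its two limits coincide.\<close>

lemma gradient_derivative_self_adjoint:
  fixes \<phi> :: "'a::real_inner \<Rightarrow> real"
  assumes ev: "\<forall>\<^sub>F x in nhds x0. GDERIV \<phi> x :> G x"
    and G: "(G has_derivative L) (at x0)"
  shows "self_adjoint L"
proof -
  have "u \<bullet> L v = v \<bullet> L u" for u v
  proof (rule tendsto_unique[OF _ young_difference_quotient[OF assms]])
    show "((\<lambda>t. (\<phi> (x0 + t *\<^sub>R u + t *\<^sub>R v) - \<phi> (x0 + t *\<^sub>R u) - \<phi> (x0 + t *\<^sub>R v) + \<phi> x0) / t\<^sup>2)
      \<longlongrightarrow> v \<bullet> L u) (at_right 0)"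
      using young_difference_quotient[OF assms, of v u] by (simp add: algebra_simps)
  qed simp
  thus ?thesis using G has_derivative_linear by (auto simp: self_adjoint_def)
qed

section \<open>Spectral facts for self-adjoint maps\<close>

lemma self_adjoint_max_eigenvector:
  fixes L :: "'a::euclidean_space \<Rightarrow> 'a"
  assumes "self_adjoint L"
  obtains e c where "norm e = 1" "L e = c *\<^sub>R e" "\<And>v. v \<bullet> L v \<le> c * (v \<bullet> v)"
proof -
  have lin: "linear L" and sym: "\<And>u v. u \<bullet> L v = v \<bullet> L u"
    using assms by (auto simp: self_adjoint_def)
  have "continuous_on (sphere 0 1) (\<lambda>v. v \<bullet> L v)"
    using lin by (intro continuous_intros linear_continuous_on) (simp add: linear_linear)
  moreover have "sphere (0::'a) 1 \<noteq> {}" by simp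
  ultimately obtain e where e: "e \<in> sphere 0 1" "\<And>v. v \<in> sphere 0 1 \<Longrightarrow> v \<bullet> L v \<le> e \<bullet> L e"
    using continuous_attains_sup[OF compact_sphere] by blast
  define c where "c = e \<bullet> L e"
  have ne: "norm e = 1" "e \<bullet> e = 1" using e by (auto simp: dot_square_norm)
  have bd: "v \<bullet> L v \<le> c * (v \<bullet> v)" for v
  proof (cases "v = 0")
    case False
    have "(v /\<^sub>R norm v) \<bullet> L (v /\<^sub>R norm v) \<le> c"
      unfolding c_def using False by (intro e) simp
    hence "(v \<bullet> L v) / (norm v)\<^sup>2 \<le> c"
      by (simp add: linear_scale[OF lin] power2_eq_square divide_simps)
    thus ?thesis using False by (simp add: dot_square_norm pos_divide_le_eq)
  qed (simp add: linear_0[OF lin])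
  \<comment> \<open>\<open>e\<close> maximizes the quadratic form on the sphere. Moving from
    \<open>e\<close> along the residual \<open>h\<close> respects the bound \<open>bd\<close> only
    if \<open>2 * t * (h \<bullet> h) + t\<^sup>2 * b \<ge> 0\<close> for every \<open>t\<close>;
    short negative \<open>t\<close> then force \<open>h = 0\<close>.\<close>
  define h where "h = c *\<^sub>R e - L e"
  define b where "b = c * (h \<bullet> h) - h \<bullet> L h"
  have q: "2 * t * (h \<bullet> h) + t\<^sup>2 * b \<ge> 0" for t
  proof -
    have "(e + t *\<^sub>R h) \<bullet> L (e + t *\<^sub>R h) \<le> c * ((e + t *\<^sub>R h) \<bullet> (e + t *\<^sub>R h))" by (rule bd)
    moreover have "(e + t *\<^sub>R h) \<bullet> L (e + t *\<^sub>R h) = c + 2 * t * (h \<bullet> L e) + t\<^sup>2 * (h \<bullet> L h)"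
      using sym[of e h] by (simp add: linear_add[OF lin] linear_scale[OF lin] inner_add_left inner_add_right c_def power2_eq_square algebra_simps)
    moreover have "(e + t *\<^sub>R h) \<bullet> (e + t *\<^sub>R h) = 1 + 2 * t * (h \<bullet> e) + t\<^sup>2 * (h \<bullet> h)"
      using ne by (simp add: inner_add_left inner_add_right inner_commute power2_eq_square algebra_simps)
    moreover have "L e = c *\<^sub>R e - h" by (simp add: h_def)
    hence "h \<bullet> L e = c * (h \<bullet> e) - h \<bullet> h" by (simp add: inner_diff_right)
    ultimately have "c + 2 * t * (c * (h \<bullet> e) - h \<bullet> h) + t\<^sup>2 * (h \<bullet> L h) \<le> c * (1 + 2 * t * (h \<bullet> e) + t\<^sup>2 * (h \<bullet> h))"
      by metis
    thus ?thesis by (simp add: b_def algebra_simps)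
  qed
  have "h \<bullet> h = 0"
  proof (rule ccontr)
    assume "h \<bullet> h \<noteq> 0"
    hence hp: "h \<bullet> h > 0" by simp
    define t where "t = - (h \<bullet> h) / (1 + \<bar>b\<bar>)"
    have t0: "t < 0" using hp by (simp add: t_def divide_neg_pos)
    have "t * (2 * (h \<bullet> h) + t * b) \<ge> 0" using q[of t] by (simp add: power2_eq_square algebra_simps)
    hence "2 * (h \<bullet> h) + t * b \<le> 0" using t0 by (simp add: zero_le_mult_iff)
    moreover have "\<bar>t * b\<bar> \<le> h \<bullet> h"
    proof -
      have "\<bar>b\<bar> / (1 + \<bar>b\<bar>) \<le> 1" by simp
      hence "(h \<bullet> h) * (\<bar>b\<bar> / (1 + \<bar>b\<bar>)) \<le> (h \<bullet> h) * 1" using hp by (intro mult_left_mono) auto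
      moreover have "\<bar>t * b\<bar> = (h \<bullet> h) * (\<bar>b\<bar> / (1 + \<bar>b\<bar>))"
        using hp by (simp add: t_def abs_mult abs_divide)
      ultimately show ?thesis by simp
    qed
    ultimately show False using hp by linarith
  qed
  hence "L e = c *\<^sub>R e" by (simp add: h_def)
  thus ?thesis using that ne bd by blast
qed

text \<open>Makes \<open>Max\<close> in \<open>P1_plus\<close> a genuine maximum. Eigenvectors for
  distinct eigenvalues are orthogonal, so one per eigenvalue gives an independent set.\<close>

lemma finite_eigenvalues:
  fixes X :: "real^'n^'n"
  assumes "self_adjoint ((*v) X)"
  shows "finite (eigenvalues X)"
proof -
  have "\<forall>c\<in>eigenvalues X. \<exists>v. v \<noteq> 0 \<and> X *v v = c *\<^sub>R v" by (simp add: eigenvalues_def)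
  then obtain V where V: "\<And>c. c \<in> eigenvalues X \<Longrightarrow> V c \<noteq> 0 \<and> X *v V c = c *\<^sub>R V c" by metis
  have orth: "V c \<bullet> V d = 0" if "c \<in> eigenvalues X" "d \<in> eigenvalues X" "c \<noteq> d" for c d
  proof -
    have "V c \<bullet> (X *v V d) = V d \<bullet> (X *v V c)" using assms by (simp add: self_adjoint_def)
    hence "d * (V c \<bullet> V d) = c * (V c \<bullet> V d)" using V that by (simp add: inner_commute)
    thus ?thesis using that by simp
  qed
  have inj: "inj_on V (eigenvalues X)"
    by (rule inj_onI) (metis orth V inner_eq_zero_iff)
  have "pairwise orthogonal (V ` eigenvalues X)"
    using orth by (auto simp: pairwise_def orthogonal_def)
  moreover have "0 \<notin> V ` eigenvalues X" using V by auto
  ultimately have "independent (V ` eigenvalues X)"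
    by (rule pairwise_orthogonal_independent)
  hence "finite (V ` eigenvalues X)" using independent_bound by blast
  thus ?thesis using inj finite_imageD by blast
qed

text \<open>Later arguments use \<open>P1_plus\<close> only through these two properties: it bounds
  the quadratic form and belongs to a unit eigenvector.\<close>

lemma P1_plus_rayleigh:
  fixes X :: "real^'n^'n"
  assumes "self_adjoint ((*v) X)"
  shows "v \<bullet> (X *v v) \<le> P1_plus X * (v \<bullet> v)"
    and "\<exists>e. norm e = 1 \<and> X *v e = P1_plus X *\<^sub>R e"
proof -
  obtain e c where e: "norm e = 1" "X *v e = c *\<^sub>R e" "\<And>v. v \<bullet> (X *v v) \<le> c * (v \<bullet> v)"
    using self_adjoint_max_eigenvector[OF assms] by metis
  have "P1_plus X = c" unfolding P1_plus_def
  proof (rule Max_eqI)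
    show "finite (eigenvalues X)" by (rule finite_eigenvalues[OF assms])
    show "c \<in> eigenvalues X" using e by (auto simp: eigenvalues_def intro!: exI[of _ e])
    fix d assume "d \<in> eigenvalues X"
    then obtain w where w: "w \<noteq> 0" "X *v w = d *\<^sub>R w" by (auto simp: eigenvalues_def)
    have "d * (w \<bullet> w) \<le> c * (w \<bullet> w)" using e(3)[of w] w by simp
    thus "d \<le> c" using w by (simp add: mult_le_cancel_right)
  qed
  thus "v \<bullet> (X *v v) \<le> P1_plus X * (v \<bullet> v)" "\<exists>e. norm e = 1 \<and> X *v e = P1_plus X *\<^sub>R e"
    using e by auto
qed

section \<open>Viscosity inequalities tested with quadratic functions\<close>

text \<open>
  For a unit vector \<open>e\<close>, \<open>quad_test p e l K\<close> has the second derivative \<open>l\<close> along \<open>e\<close> and \<open>-K\<close> orthogonally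
  to \<open>e\<close>. With \<open>K\<close> large these functions lie, up to an arbitrarily small multiple of \<open>\<bar>y\<bar>\<^sup>2\<close>, below the
  second-order expansion of any test function with top eigenvector \<open>e\<close>; from above, isotropic
  paraboloids suffice.
\<close>

definition quad_test :: "'a::real_inner \<Rightarrow> 'a \<Rightarrow> real \<Rightarrow> real \<Rightarrow> 'a \<Rightarrow> real" where
  "quad_test p e l K y = p \<bullet> y + l / 2 * (e \<bullet> y)\<^sup>2 - K / 2 * (y \<bullet> y - (e \<bullet> y)\<^sup>2)"

text \<open>Semicontinuity is left out of \<open>quad_super\<close> and \<open>quad_sub\<close>, to
  be supplied or derived separately. No matrices occur, so the main argument can take place in an
  arbitrary Euclidean space.\<close>

definition quad_super :: "'a::real_inner set \<Rightarrow> real \<Rightarrow> ('a \<Rightarrow> real) \<Rightarrow> ('a \<Rightarrow> real) \<Rightarrow> bool" where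
  "quad_super \<Omega> \<mu> f v \<longleftrightarrow> (\<forall>x0\<in>\<Omega>. \<forall>p e l K. norm e = 1 \<longrightarrow>
     (\<forall>\<^sub>F x in nhds x0. v x0 + quad_test p e l K (x - x0) \<le> v x) \<longrightarrow> l + \<mu> * v x0 \<le> f x0)"

definition quad_sub :: "'a::real_inner set \<Rightarrow> real \<Rightarrow> ('a \<Rightarrow> real) \<Rightarrow> ('a \<Rightarrow> real) \<Rightarrow> bool" where
  "quad_sub \<Omega> \<mu> f u \<longleftrightarrow> (\<forall>x0\<in>\<Omega>. \<forall>p c.
     (\<forall>\<^sub>F x in nhds x0. u x \<le> u x0 + p \<bullet> (x - x0) + c / 2 * ((x - x0) \<bullet> (x - x0))) \<longrightarrow>
     f x0 \<le> c + \<mu> * u x0)"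

lemma quad_superD:
  assumes "quad_super \<Omega> \<mu> f v" "x0 \<in> \<Omega>" "norm e = 1"
    "\<forall>\<^sub>F x in nhds x0. v x0 + quad_test p e l K (x - x0) \<le> v x"
  shows "l + \<mu> * v x0 \<le> f x0"
  using assms unfolding quad_super_def by blast

lemma quad_subD:
  assumes "quad_sub \<Omega> \<mu> f u" "x0 \<in> \<Omega>"
    "\<forall>\<^sub>F x in nhds x0. u x \<le> u x0 + p \<bullet> (x - x0) + c / 2 * ((x - x0) \<bullet> (x - x0))"
  shows "f x0 \<le> c + \<mu> * u x0"
  using assms unfolding quad_sub_def by blast

section \<open>Equivalence of quadratic tests and twice continuously differentiable tests\<close>

lemma eventually_at_within_open_nhds:
  assumes "open \<Omega>" "x0 \<in> \<Omega>" "P x0"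
  shows "(\<forall>\<^sub>F x in at x0 within \<Omega>. P x) \<longleftrightarrow> (\<forall>\<^sub>F x in nhds x0. P x)"
  unfolding at_within_open[OF assms(2,1)] eventually_nhds_conv_at using assms(3) by blast

text \<open>The matrix (l + K) e e^T - K I, the Hessian of \<open>quad_test p e l K\<close>.\<close>

definition quad_hessian :: "real^'n \<Rightarrow> real \<Rightarrow> real \<Rightarrow> real^'n^'n" where
  "quad_hessian e l K = (\<chi> i j. (l + K) * (e $ i) * (e $ j) - (if i = j then K else 0))"

lemma quad_hessian_mult:
  "quad_hessian e l K *v h = (l + K) *\<^sub>R ((e \<bullet> h) *\<^sub>R e) - K *\<^sub>R h"
proof (rule vec_eq_iff[THEN iffD2, rule_format])
  fix i
  have "(quad_hessian e l K *v h) $ i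
      = (\<Sum>j\<in>UNIV. (l + K) * e $ i * (e $ j * h $ j)) - (\<Sum>j\<in>UNIV. (if i = j then K * h $ j else 0))"
    unfolding matrix_vector_mult_def quad_hessian_def
    by (simp add: sum_subtractf[symmetric] del: sum.delta sum.delta') (rule sum.cong, auto simp: algebra_simps)
  also have "\<dots> = (l + K) * e $ i * (\<Sum>j\<in>UNIV. e $ j * h $ j) - K * h $ i"
    by (simp add: sum_distrib_left[symmetric])
  also have "\<dots> = ((l + K) *\<^sub>R ((e \<bullet> h) *\<^sub>R e) - K *\<^sub>R h) $ i"
    by (simp add: inner_vec_def algebra_simps)
  finally show "(quad_hessian e l K *v h) $ i = ((l + K) *\<^sub>R ((e \<bullet> h) *\<^sub>R e) - K *\<^sub>R h) $ i" .
qed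

lemma C2_near_quad:
  fixes x0 :: "real^'n"
  shows "C2_near x0 (\<lambda>x. a + quad_test p e l K (x - x0))
    (\<lambda>x. p + quad_hessian e l K *v (x - x0)) (\<lambda>_. quad_hessian e l K)"
  unfolding C2_near_def
proof (intro exI[of _ UNIV] conjI ballI)
  fix x :: "real^'n"
  show "GDERIV (\<lambda>x. a + quad_test p e l K (x - x0)) x :> p + quad_hessian e l K *v (x - x0)"
    unfolding gderiv_def quad_test_def quad_hessian_mult power2_eq_square
    apply (rule derivative_eq_intros refl)+
    apply (simp add: fun_eq_iff inner_add_right inner_diff_right inner_diff_left)
    by (auto simp: field_simps inner_commute)
  show "((\<lambda>x. p + quad_hessian e l K *v (x - x0)) has_derivative (*v) (quad_hessian e l K)) (at x)"
    unfolding quad_hessian_mult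
    apply (rule derivative_eq_intros refl)+
    by (simp add: fun_eq_iff quad_hessian_mult)
qed auto

lemma self_adjoint_quad_hessian: "self_adjoint ((*v) (quad_hessian e l K))"
  unfolding self_adjoint_def
  by (auto simp: quad_hessian_mult inner_diff_right inner_commute)

lemma quad_hessian_form:
  "y \<bullet> (quad_hessian e l K *v y) = l * (e \<bullet> y)\<^sup>2 - K * (y \<bullet> y - (e \<bullet> y)\<^sup>2)"
  by (simp add: quad_hessian_mult inner_diff_right inner_commute power2_eq_square algebra_simps)

lemma P1_plus_quad_hessian_ge:
  assumes "norm e = 1"
  shows "l \<le> P1_plus (quad_hessian e l K)"
proof -
  have "e \<bullet> e = 1" using assms by (simp add: dot_square_norm)
  thus ?thesis
    using P1_plus_rayleigh(1)[OF self_adjoint_quad_hessian, of e e l K] by (simp add: quad_hessian_form)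
qed

text \<open>A quadratic test function is smooth and the largest eigenvalue of its Hessian is at
  least \<open>l\<close>, so the viscosity inequality for it implies the one for
  \<open>l\<close>.\<close>

lemma visc_supersol_imp_quad_super:
  fixes \<Omega> :: "(real^'n) set"
  assumes "open \<Omega>" "visc_supersol \<Omega> \<mu> f v"
  shows "quad_super \<Omega> \<mu> f v"
  unfolding quad_super_def
proof (intro ballI allI impI)
  fix x0 p e l K
  assume x0: "x0 \<in> \<Omega>" and e: "norm e = 1"
    and t: "\<forall>\<^sub>F x in nhds x0. v x0 + quad_test p e l K (x - x0) \<le> v x"
  let ?\<phi> = "\<lambda>x. 0 + quad_test p e l K (x - x0)"
  have "\<forall>\<^sub>F x in nhds x0. v x0 - ?\<phi> x0 \<le> v x - ?\<phi> x"
    using t by eventually_elim (simp add: quad_test_def)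
  hence "\<forall>\<^sub>F x in at x0 within \<Omega>. v x0 - ?\<phi> x0 \<le> v x - ?\<phi> x"
    by (subst eventually_at_within_open_nhds) (use assms x0 in auto)
  hence "P1_plus (quad_hessian e l K) + \<mu> * v x0 \<le> f x0"
    using assms(2) x0 C2_near_quad[of x0 0 p e l K] unfolding visc_supersol_def by blast
  thus "l + \<mu> * v x0 \<le> f x0" using P1_plus_quad_hessian_ge[OF e, of l K] by linarith
qed

lemma P1_plus_quad_hessian_isotropic:
  fixes e :: "real^'n"
  shows "P1_plus (quad_hessian e c (- c)) = c"
proof -
  obtain e' where "norm e' = 1" "quad_hessian e c (- c) *v e' = P1_plus (quad_hessian e c (- c)) *\<^sub>R e'"
    using P1_plus_rayleigh(2)[OF self_adjoint_quad_hessian] by blast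
  hence "(c - P1_plus (quad_hessian e c (- c))) *\<^sub>R e' = 0" "e' \<noteq> 0"
    by (auto simp: quad_hessian_mult algebra_simps)
  thus ?thesis by simp
qed

lemma visc_subsolD:
  assumes "visc_subsol \<Omega> \<mu> f u" "x0 \<in> \<Omega>" "C2_near x0 \<phi> G H"
    "\<forall>\<^sub>F x in at x0 within \<Omega>. u x - \<phi> x \<le> u x0 - \<phi> x0"
  shows "f x0 \<le> P1_plus (H x0) + \<mu> * u x0"
  using assms unfolding visc_subsol_def by blast

lemma visc_subsol_imp_quad_sub:
  fixes \<Omega> :: "(real^'n) set"
  assumes "open \<Omega>" "visc_subsol \<Omega> \<mu> f u"
  shows "quad_sub \<Omega> \<mu> f u"
  unfolding quad_sub_def
proof (intro ballI allI impI)
  fix x0 p c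
  assume x0: "x0 \<in> \<Omega>"
    and t: "\<forall>\<^sub>F x in nhds x0. u x \<le> u x0 + p \<bullet> (x - x0) + c / 2 * ((x - x0) \<bullet> (x - x0))"
  \<comment> \<open>With \<open>e = 0\<close> and \<open>K = - c\<close> this is the isotropic
    paraboloid \<open>p \<bullet> y + c / 2 * (y \<bullet> y)\<close>.\<close>
  let ?\<phi> = "\<lambda>x. 0 + quad_test p 0 c (- c) (x - x0)"
  have "\<forall>\<^sub>F x in nhds x0. u x - ?\<phi> x \<le> u x0 - ?\<phi> x0"
    using t by eventually_elim (simp add: quad_test_def)
  hence "\<forall>\<^sub>F x in at x0 within \<Omega>. u x - ?\<phi> x \<le> u x0 - ?\<phi> x0"
    by (subst eventually_at_within_open_nhds) (use assms x0 in auto)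
  hence "f x0 \<le> P1_plus (quad_hessian (0::real^'n) c (- c)) + \<mu> * u x0"
    using visc_subsolD[OF assms(2) x0 C2_near_quad[of x0 0 p 0 c "-c"]] by simp
  thus "f x0 \<le> c + \<mu> * u x0" by (simp add: P1_plus_quad_hessian_isotropic)
qed

lemma C2_near_expand:
  fixes x0 :: "real^'n"
  assumes "C2_near x0 \<phi> G H" "\<eta> > 0"
  shows "self_adjoint ((*v) (H x0))"
    and "\<forall>\<^sub>F x in nhds x0. \<bar>\<phi> x - \<phi> x0 - G x0 \<bullet> (x - x0) - (x - x0) \<bullet> (H x0 *v (x - x0)) / 2\<bar>
            \<le> \<eta> * ((x - x0) \<bullet> (x - x0))"
proof -
  obtain U where U: "open U" "x0 \<in> U" "\<And>x. x \<in> U \<Longrightarrow> GDERIV \<phi> x :> G x"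
    "\<And>x. x \<in> U \<Longrightarrow> (G has_derivative (\<lambda>h. H x *v h)) (at x)"
    using assms(1) unfolding C2_near_def by blast
  have ev: "\<forall>\<^sub>F x in nhds x0. GDERIV \<phi> x :> G x"
    using U by (auto simp: eventually_nhds)
  show "self_adjoint ((*v) (H x0))"
    using gradient_derivative_self_adjoint[OF ev U(4)[OF U(2)]] by simp
  show "\<forall>\<^sub>F x in nhds x0. \<bar>\<phi> x - \<phi> x0 - G x0 \<bullet> (x - x0) - (x - x0) \<bullet> (H x0 *v (x - x0)) / 2\<bar>
            \<le> \<eta> * ((x - x0) \<bullet> (x - x0))"
    using taylor_gradient[OF ev U(4)[OF U(2)] assms(2)] by simp
qed

text \<open>By Taylor's formula and the Rayleigh bound, \<phi> lies locally below the paraboloid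
  whose Hessian is \<open>P1_plus (H x0) + d\<close> times the identity. The arbitrary
  \<open>d > 0\<close> absorbs the Taylor error.\<close>

lemma quad_sub_imp_visc_subsol:
  fixes \<Omega> :: "(real^'n) set"
  assumes "open \<Omega>" "quad_sub \<Omega> \<mu> f u" "usc_on \<Omega> u"
  shows "visc_subsol \<Omega> \<mu> f u"
  unfolding visc_subsol_def
proof (intro conjI ballI allI impI; (elim conjE)?)
  fix x0 \<phi> G H
  assume x0: "x0 \<in> \<Omega>" and C2: "C2_near x0 \<phi> G H"
    and t: "\<forall>\<^sub>F x in at x0 within \<Omega>. u x - \<phi> x \<le> u x0 - \<phi> x0"
  have t': "\<forall>\<^sub>F x in nhds x0. u x - \<phi> x \<le> u x0 - \<phi> x0"
    using t by (subst (asm) eventually_at_within_open_nhds) (use assms x0 in auto)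
  show "f x0 \<le> P1_plus (H x0) + \<mu> * u x0"
  proof (rule field_le_epsilon)
    fix d :: real assume "d > 0"
    let ?c = "P1_plus (H x0) + d"
    have "\<forall>\<^sub>F x in nhds x0. \<bar>\<phi> x - \<phi> x0 - G x0 \<bullet> (x - x0) - (x - x0) \<bullet> (H x0 *v (x - x0)) / 2\<bar>
            \<le> d / 2 * ((x - x0) \<bullet> (x - x0))"
      using C2_near_expand(2)[OF C2, of "d / 2"] \<open>d > 0\<close> by simp
    with t' have "\<forall>\<^sub>F x in nhds x0. u x \<le> u x0 + G x0 \<bullet> (x - x0) + ?c / 2 * ((x - x0) \<bullet> (x - x0))"
    proof eventually_elim
      case (elim x)
      have "(x - x0) \<bullet> (H x0 *v (x - x0)) \<le> P1_plus (H x0) * ((x - x0) \<bullet> (x - x0))"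
        by (rule P1_plus_rayleigh(1)[OF C2_near_expand(1)[OF C2 \<open>d > 0\<close>]])
      moreover have "?c / 2 * ((x - x0) \<bullet> (x - x0)) = P1_plus (H x0) * ((x - x0) \<bullet> (x - x0)) / 2 + d / 2 * ((x - x0) \<bullet> (x - x0))"
        by (simp add: field_simps)
      ultimately show ?case using elim by linarith
    qed
    from quad_subD[OF assms(2) x0 this] show "f x0 \<le> P1_plus (H x0) + \<mu> * u x0 + d" by simp
  qed
qed fact

text \<open>Split \<open>y\<close> into its component along the eigenvector \<open>e\<close> and an
  orthogonal part \<open>z\<close>. The cross terms vanish, and an operator bound for
  \<open>L\<close> controls \<open>z \<bullet> L z\<close> from below.\<close>

lemma self_adjoint_lower_bound:
  fixes L :: "'a::euclidean_space \<Rightarrow> 'a"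
  assumes "self_adjoint L" "norm e = 1" "L e = c *\<^sub>R e"
  obtains K where "\<And>y. c * (e \<bullet> y)\<^sup>2 - K * (y \<bullet> y - (e \<bullet> y)\<^sup>2) \<le> y \<bullet> L y"
proof -
  have lin: "linear L" and sym: "\<And>u v. u \<bullet> L v = v \<bullet> L u"
    using assms by (auto simp: self_adjoint_def)
  obtain K where K: "\<And>x. norm (L x) \<le> K * norm x"
    using linear_bounded[OF lin] by blast
  have ee: "e \<bullet> e = 1" using assms by (simp add: dot_square_norm)
  have "c * (e \<bullet> y)\<^sup>2 - K * (y \<bullet> y - (e \<bullet> y)\<^sup>2) \<le> y \<bullet> L y" for y
  proof -
    define s where "s = e \<bullet> y"
    define z where "z = y - s *\<^sub>R e"
    have ez: "e \<bullet> z = 0" by (simp add: z_def s_def inner_diff_right ee)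
    have y: "y = z + s *\<^sub>R e" by (simp add: z_def)
    have zz: "z \<bullet> z = y \<bullet> y - s\<^sup>2"
      by (simp add: z_def inner_diff_left inner_diff_right ee inner_commute s_def power2_eq_square)
    have "y \<bullet> L y = z \<bullet> L z + c * s\<^sup>2"
      using ez sym[of z e] assms(3) unfolding y
      by (simp add: linear_add[OF lin] linear_scale[OF lin] inner_add_left inner_add_right ee
          power2_eq_square inner_commute)
    moreover have "\<bar>z \<bullet> L z\<bar> \<le> norm z * (K * norm z)"
      using Cauchy_Schwarz_ineq2[of z "L z"] mult_left_mono[OF K[of z], of "norm z"] by force
    hence "- K * (z \<bullet> z) \<le> z \<bullet> L z" by (simp add: dot_square_norm power2_eq_square algebra_simps)
    ultimately show ?thesis using zz by (simp add: s_def)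
  qed
  thus ?thesis using that by blast
qed

text \<open>For a top eigenvector \<open>e\<close>, a \<open>quad_test\<close> with all curvatures
  lowered by \<open>d\<close> lies below the expansion of \<phi>, Taylor error included, so it still
  touches \<open>v\<close> from below.\<close>

lemma quad_super_imp_visc_supersol:
  fixes \<Omega> :: "(real^'n) set"
  assumes "open \<Omega>" "quad_super \<Omega> \<mu> f v" "lsc_on \<Omega> v"
  shows "visc_supersol \<Omega> \<mu> f v"
  unfolding visc_supersol_def
proof (intro conjI ballI allI impI; (elim conjE)?)
  fix x0 \<phi> G H
  assume x0: "x0 \<in> \<Omega>" and C2: "C2_near x0 \<phi> G H"
    and t: "\<forall>\<^sub>F x in at x0 within \<Omega>. v x0 - \<phi> x0 \<le> v x - \<phi> x"
  have t': "\<forall>\<^sub>F x in nhds x0. v x0 - \<phi> x0 \<le> v x - \<phi> x"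
    using t by (subst (asm) eventually_at_within_open_nhds) (use assms x0 in auto)
  have sa: "self_adjoint ((*v) (H x0))" by (rule C2_near_expand(1)[OF C2 zero_less_one])
  obtain e where e: "norm e = 1" "H x0 *v e = P1_plus (H x0) *\<^sub>R e"
    using P1_plus_rayleigh(2)[OF sa] by blast
  obtain K where K: "\<And>y. P1_plus (H x0) * (e \<bullet> y)\<^sup>2 - K * (y \<bullet> y - (e \<bullet> y)\<^sup>2) \<le> y \<bullet> (H x0 *v y)"
    using self_adjoint_lower_bound[OF sa e] by blast
  show "P1_plus (H x0) + \<mu> * v x0 \<le> f x0"
  proof (rule field_le_epsilon)
    fix d :: real assume "d > 0"
    have "\<forall>\<^sub>F x in nhds x0. \<bar>\<phi> x - \<phi> x0 - G x0 \<bullet> (x - x0) - (x - x0) \<bullet> (H x0 *v (x - x0)) / 2\<bar>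
            \<le> d / 2 * ((x - x0) \<bullet> (x - x0))"
      using C2_near_expand(2)[OF C2, of "d / 2"] \<open>d > 0\<close> by simp
    with t' have "\<forall>\<^sub>F x in nhds x0. v x0 + quad_test (G x0) e (P1_plus (H x0) - d) (K + d) (x - x0) \<le> v x"
    proof eventually_elim
      case (elim x)
      have "quad_test (G x0) e (P1_plus (H x0) - d) (K + d) (x - x0) =
        G x0 \<bullet> (x - x0) + (P1_plus (H x0) * (e \<bullet> (x - x0))\<^sup>2 - K * ((x - x0) \<bullet> (x - x0) - (e \<bullet> (x - x0))\<^sup>2)) / 2
         - d / 2 * ((x - x0) \<bullet> (x - x0))"
        by (simp add: quad_test_def field_simps)
      moreover have "v0 + q \<le> vx"
        if "v0 - p0 \<le> vx - px" "\<bar>px - p0 - g - h / 2\<bar> \<le> D" "r \<le> h" "q = g + r / 2 - D"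
        for v0 p0 vx px g h D r q :: real
        using that by linarith
      ultimately show ?case using elim K[of "x - x0"] by blast
    qed
    from quad_superD[OF assms(2) x0 e(1) this] show "P1_plus (H x0) + \<mu> * v x0 \<le> f x0 + d" by simp
  qed
qed fact

section \<open>Semiconcavity of supersolutions\<close>

text \<open>Without a minimum, every \<open>x\<close> has some \<open>Y x\<close> of smaller value
  and a neighbourhood on which \<open>v\<close> exceeds \<open>v (Y x)\<close>. In a finite subcover
  the smallest of the values \<open>v (Y x)\<close> is then undercut by another one.\<close>

lemma lsc_attains_inf:
  fixes v :: "'a::topological_space \<Rightarrow> real"
  assumes "compact S" "S \<noteq> {}" "lsc_on S v"
  obtains x where "x \<in> S" "\<And>y. y \<in> S \<Longrightarrow> v x \<le> v y"
proof -
  have "\<exists>x\<in>S. \<forall>y\<in>S. v x \<le> v y"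
  proof (rule ccontr)
    assume "\<not> ?thesis"
    hence "\<forall>x\<in>S. \<exists>y\<in>S. v y < v x" by (meson not_le)
    then obtain Y where Y: "\<And>x. x \<in> S \<Longrightarrow> Y x \<in> S" "\<And>x. x \<in> S \<Longrightarrow> v (Y x) < v x" by metis
    have "\<exists>T. open T \<and> x \<in> T \<and> (\<forall>z\<in>T \<inter> S. v (Y x) < v z)" if x: "x \<in> S" for x
    proof -
      have "\<forall>\<^sub>F z in at x within S. v (Y x) < v z"
        using assms(3) x Y(2)[OF x] unfolding lsc_on_def by blast
      then obtain T where T: "open T" "x \<in> T" "\<And>z. z \<in> T \<Longrightarrow> z \<noteq> x \<Longrightarrow> z \<in> S \<Longrightarrow> v (Y x) < v z"
        unfolding eventually_at_topological by blast
      have "v (Y x) < v z" if "z \<in> T \<inter> S" for z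
        using T(3)[of z] Y(2)[OF x] that by (cases "z = x") auto
      thus ?thesis using T(1,2) by blast
    qed
    then obtain T where T: "\<And>x. x \<in> S \<Longrightarrow> open (T x)" "\<And>x. x \<in> S \<Longrightarrow> x \<in> T x"
      "\<And>x z. x \<in> S \<Longrightarrow> z \<in> T x \<inter> S \<Longrightarrow> v (Y x) < v z" by metis
    obtain C where C: "C \<subseteq> S" "finite C" "S \<subseteq> (\<Union>x\<in>C. T x)"
      by (rule compactE_image[OF assms(1), of S T]) (use T(1,2) in auto)
    have "C \<noteq> {}" using C assms(2) by auto
    hence "Min ((\<lambda>x. v (Y x)) ` C) \<in> (\<lambda>x. v (Y x)) ` C" using C(2) by (intro Min_in) auto
    then obtain x where x: "x \<in> C" "v (Y x) = Min ((\<lambda>x. v (Y x)) ` C)" by (metis imageE)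
    have min: "v (Y x) \<le> v (Y x')" if "x' \<in> C" for x' using that C(2) unfolding x(2) by (intro Min_le) auto
    have "Y x \<in> S" using x(1) C(1) Y(1) by blast
    then obtain x' where "x' \<in> C" "Y x \<in> T x'" using C(3) by blast
    hence "v (Y x') < v (Y x)" using T(3)[of x' "Y x"] C(1) \<open>Y x \<in> S\<close> by blast
    thus False using min[OF \<open>x' \<in> C\<close>] by simp
  qed
  thus ?thesis using that by blast
qed

lemma lsc_on_subset: "lsc_on S v \<Longrightarrow> T \<subseteq> S \<Longrightarrow> lsc_on T v"
  unfolding lsc_on_def using filter_leD[OF at_le] by (metis subsetD)

lemma continuous_on_imp_lsc_on: "continuous_on S v \<Longrightarrow> lsc_on S v"
  unfolding lsc_on_def continuous_on_def by (auto dest: order_tendstoD(1))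

lemma continuous_on_imp_usc_on: "continuous_on S v \<Longrightarrow> usc_on S v"
  unfolding usc_on_def continuous_on_def by (auto dest: order_tendstoD(2))

lemma continuous_on_eventually_order:
  fixes g :: "'a::t2_space \<Rightarrow> real"
  assumes "open S" "continuous_on S g" "x0 \<in> S"
  shows "g x0 < c \<Longrightarrow> \<forall>\<^sub>F x in nhds x0. x \<in> S \<and> g x < c"
    and "c < g x0 \<Longrightarrow> \<forall>\<^sub>F x in nhds x0. x \<in> S \<and> c < g x"
proof -
  have t: "(g \<longlongrightarrow> g x0) (nhds x0)"
  proof -
    have "isCont g x0" using assms continuous_on_eq_continuous_at by blast
    thus ?thesis unfolding isCont_def by (rule tendsto_at_iff_tendsto_nhds[THEN iffD1])
  qed
  have S: "\<forall>\<^sub>F x in nhds x0. x \<in> S" using assms eventually_nhds by blast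
  show "g x0 < c \<Longrightarrow> \<forall>\<^sub>F x in nhds x0. x \<in> S \<and> g x < c"
    using S order_tendstoD(2)[OF t] by (simp add: eventually_conj)
  show "c < g x0 \<Longrightarrow> \<forall>\<^sub>F x in nhds x0. x \<in> S \<and> c < g x"
    using S order_tendstoD(1)[OF t] by (simp add: eventually_conj)
qed

lemma lsc_on_diff_continuous:
  assumes "lsc_on S v" "continuous_on S h"
  shows "lsc_on S (\<lambda>x. v x - h x :: real)"
  unfolding lsc_on_def
proof (intro ballI allI impI)
  fix x a assume x: "x \<in> S" and a: "a < v x - h x"
  define d where "d = (v x - h x - a) / 2"
  have d: "d > 0" "a = v x - d - (h x + d)" using a by (auto simp: d_def field_simps)
  have "\<forall>\<^sub>F y in at x within S. v x - d < v y"
    using assms(1) x d(1) unfolding lsc_on_def by auto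
  moreover have "\<forall>\<^sub>F y in at x within S. h y < h x + d"
    using assms(2) x d(1) unfolding continuous_on_def by (intro order_tendstoD(2)) auto
  ultimately show "\<forall>\<^sub>F y in at x within S. a < v y - h y"
    by eventually_elim (use d in linarith)
qed

text \<open>
  If \<open>v - C\<bar>x\<bar>\<^sup>2/2\<close> falls below its chord somewhere on a segment, then a test function that is
  slightly more convex than the chord along the segment and very concave across it touches \<open>v\<close> from
  below in the interior of a thin cylinder around the segment.
\<close>

lemma quad_super_concave_segment:
  fixes v :: "'a::euclidean_space \<Rightarrow> real"
  assumes op: "open \<Omega>" and cv: "convex \<Omega>" and lsc: "lsc_on \<Omega> v" and sup: "quad_super \<Omega> 0 (\<lambda>_. C) v"
    and x: "x \<in> \<Omega>" and y: "x + L *\<^sub>R e \<in> \<Omega>" and e: "norm e = 1" and L: "L > 0" and w: "0 < w" "w < 1"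
  defines "g \<equiv> \<lambda>p. v p - C / 2 * (p \<bullet> p)"
  shows "(1 - w) * g x + w * g (x + L *\<^sub>R e) \<le> g (x + (w * L) *\<^sub>R e)"
proof (rule ccontr)
  define y' where "y' = x + L *\<^sub>R e"
  define z where "z = x + (w * L) *\<^sub>R e"
  define m where "m = (1 - w) * g x + w * g y' - g z"
  assume "\<not> ?thesis"
  hence m: "m > 0" by (simp add: m_def y'_def z_def)
  have ee: "e \<bullet> e = 1" using e by (simp add: dot_square_norm)
  have glsc: "lsc_on \<Omega> g" unfolding g_def by (intro lsc_on_diff_continuous lsc continuous_intros)
  have near: "\<exists>r>0. \<forall>p. dist p a < r \<longrightarrow> p \<in> \<Omega> \<and> g a - m / 3 < g p" if a: "a \<in> \<Omega>" for a
  proof -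
    have "\<forall>\<^sub>F p in at a within \<Omega>. g a - m / 3 < g p"
      using glsc a m unfolding lsc_on_def by simp
    hence "\<forall>\<^sub>F p in nhds a. g a - m / 3 < g p"
      by (subst (asm) eventually_at_within_open_nhds) (use a op m in auto)
    moreover have "\<forall>\<^sub>F p in nhds a. p \<in> \<Omega>" using a op eventually_nhds by blast
    ultimately have "\<forall>\<^sub>F p in nhds a. p \<in> \<Omega> \<and> g a - m / 3 < g p" by eventually_elim simp
    thus ?thesis unfolding eventually_nhds_metric .
  qed
  obtain r1 where r1: "r1 > 0" "\<And>p. dist p x < r1 \<Longrightarrow> p \<in> \<Omega> \<and> g x - m / 3 < g p"
    using near[OF x] by blast
  obtain r2 where r2: "r2 > 0" "\<And>p. dist p y' < r2 \<Longrightarrow> p \<in> \<Omega> \<and> g y' - m / 3 < g p"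
    using near[of y'] y unfolding y'_def by blast
  define r where "r = min r1 r2 / 2"
  have r: "r > 0" "r < r1" "r < r2" using r1 r2 by (auto simp: r_def)
  \<comment> \<open>Cylinder coordinates: \<open>s p\<close> along the axis from \<open>x\<close>,
    and \<open>q p\<close> the offset orthogonal to it. \<open>Z\<close> is the cylinder of radius
    \<open>r\<close> around the segment; on its end discs \<open>g\<close> stays above its value at
    the end point minus \<open>m / 3\<close>.\<close>
  define s where "s = (\<lambda>p. e \<bullet> (p - x))"
  define q where "q = (\<lambda>p. p - x - s p *\<^sub>R e)"
  define Z where "Z = {p. 0 \<le> s p \<and> s p \<le> L \<and> norm (q p) \<le> r}"
  have qq: "q p \<bullet> q p = (p - x) \<bullet> (p - x) - (s p)\<^sup>2" for p
    by (simp add: q_def s_def inner_diff_left inner_diff_right ee inner_commute power2_eq_square algebra_simps)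
  have pq: "p = x + q p + s p *\<^sub>R e" for p by (simp add: q_def)
  have conts: "continuous_on A s" for A unfolding s_def by (intro continuous_intros)
  have contq: "continuous_on A q" for A unfolding q_def by (intro continuous_intros conts)
  \<comment> \<open>A point of the cylinder lies on the segment joining the two end points
    translated by the same offset \<open>q p\<close>.\<close>
  have "Z \<subseteq> \<Omega>"
  proof
    fix p assume p: "p \<in> Z"
    have "x + q p \<in> \<Omega>" using p r by (intro r1(2)[THEN conjunct1]) (simp add: Z_def dist_norm)
    moreover have "y' + q p \<in> \<Omega>" using p r by (intro r2(2)[THEN conjunct1]) (simp add: Z_def dist_norm)
    moreover have "p = (1 - s p / L) *\<^sub>R (x + q p) + (s p / L) *\<^sub>R (y' + q p)"
      using L by (subst pq) (simp add: y'_def algebra_simps)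
    ultimately show "p \<in> \<Omega>"
      using cv p L unfolding Z_def by (metis (no_types, lifting) convex_alt mem_Collect_eq zero_le_divide_iff divide_le_eq_1_pos less_eq_real_def)
  qed
  have "closed Z" unfolding Z_def
    by (intro closed_Collect_conj closed_Collect_le continuous_intros conts contq)
  moreover have "bounded Z"
  proof (rule boundedI)
    fix p assume p: "p \<in> Z"
    have "norm p \<le> norm x + norm (q p) + norm (s p *\<^sub>R e)"
      by (subst pq) (meson norm_triangle_ineq norm_triangle_le add_mono order_refl order_trans)
    also have "\<dots> \<le> norm x + r + L" using p e by (simp add: Z_def)
    finally show "norm p \<le> norm x + r + L" .
  qed
  ultimately have compZ: "compact Z" by (simp add: compact_eq_bounded_closed)
  have sz: "s z = w * L" by (simp add: s_def z_def ee)
  have qz: "q z = 0" unfolding q_def sz by (simp add: z_def)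
  have "z \<in> Z" using w L r by (simp add: Z_def sz qz)
  obtain b where b: "\<And>p. p \<in> Z \<Longrightarrow> g b \<le> g p"
    using lsc_attains_inf[OF compZ _ lsc_on_subset[OF glsc \<open>Z \<subseteq> \<Omega>\<close>]] \<open>z \<in> Z\<close> by blast
  \<comment> \<open>\<open>F\<close> compares \<open>g\<close> with the chord \<open>h\<close>, made
    slightly convex by \<delta> and penalized off the axis by \<open>K\<close>. The choice of
    \<delta> keeps the convex term below \<open>m / 3\<close>; \<open>K\<close>, through the minimum
    \<open>g b\<close>, lifts \<open>F\<close> above \<open>- m\<close> on the lateral
    surface.\<close>
  define \<delta> where "\<delta> = m / (3 * L\<^sup>2)"
  have \<delta>: "\<delta> > 0" using m L by (simp add: \<delta>_def)
  define h where "h = (\<lambda>p. g x + s p / L * (g y' - g x))"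
  define B where "B = \<bar>g x\<bar> + \<bar>g y' - g x\<bar>"
  define K where "K = (\<bar>g b\<bar> + B + m) / r\<^sup>2"
  define F where "F = (\<lambda>p. g p - h p - \<delta> * (s p)\<^sup>2 + K * (q p \<bullet> q p))"
  have "lsc_on Z (\<lambda>p. g p - (h p + \<delta> * (s p)\<^sup>2 - K * (q p \<bullet> q p)))"
    using L by (intro lsc_on_diff_continuous lsc_on_subset[OF glsc \<open>Z \<subseteq> \<Omega>\<close>])
      (auto simp: h_def intro!: continuous_intros conts contq)
  hence "lsc_on Z F" unfolding F_def by (simp add: algebra_simps)
  then obtain p where p: "p \<in> Z" "\<And>p'. p' \<in> Z \<Longrightarrow> F p \<le> F p'"
    using lsc_attains_inf[OF compZ] \<open>z \<in> Z\<close> by (metis empty_iff)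
  have Fz: "F z \<le> - m"
  proof -
    have "h z = (1 - w) * g x + w * g y'" using L by (simp add: h_def sz algebra_simps)
    thus ?thesis using \<delta> by (simp add: F_def qz m_def)
  qed
  have Fp: "F p \<le> - m" using p(2)[OF \<open>z \<in> Z\<close>] Fz by simp
  have ds: "\<delta> * (s p)\<^sup>2 \<le> m / 3"
  proof -
    have "(s p)\<^sup>2 \<le> L\<^sup>2" using p(1) by (intro power_mono) (auto simp: Z_def)
    hence "\<delta> * (s p)\<^sup>2 \<le> \<delta> * L\<^sup>2" using \<delta> by simp
    thus ?thesis using L by (simp add: \<delta>_def)
  qed
  have K0: "K \<ge> 0" using m by (simp add: K_def B_def)
  have Kq: "K * (q p \<bullet> q p) \<ge> 0" using K0 by simp
  \<comment> \<open>The minimizer has \<open>F p \<le> - m\<close>, whereas \<open>F > - m\<close>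
    on both end discs and on the lateral surface; hence \<open>p\<close> is interior to
    \<open>Z\<close>.\<close>
  have 1: "s p \<noteq> 0"
  proof
    assume s0: "s p = 0"
    hence "dist p x < r1" using p(1) r pq[of p] unfolding Z_def dist_norm q_def by simp
    hence "g x - m / 3 < g p" using r1 by blast
    thus False using Fp Kq m s0 by (simp add: F_def h_def)
  qed
  have 2: "s p \<noteq> L"
  proof
    assume s0: "s p = L"
    have "p - y' = q p" unfolding q_def s0 y'_def by simp
    hence "dist p y' < r2" using p(1) r unfolding Z_def dist_norm by simp
    hence "g y' - m / 3 < g p" using r2 by blast
    moreover have "h p = g y'" using L s0 by (simp add: h_def)
    ultimately show False using Fp Kq m ds unfolding F_def by linarith
  qed
  have 3: "norm (q p) \<noteq> r"
  proof
    assume "norm (q p) = r"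
    hence "K * (q p \<bullet> q p) = \<bar>g b\<bar> + B + m" using r by (simp add: K_def dot_square_norm)
    moreover have "h p \<le> B"
    proof -
      have "s p / L * (g y' - g x) \<le> s p / L * \<bar>g y' - g x\<bar>"
        using p(1) L by (intro mult_left_mono) (auto simp: Z_def)
      also have "\<dots> \<le> 1 * \<bar>g y' - g x\<bar>"
        using p(1) L by (intro mult_right_mono) (auto simp: Z_def)
      finally have "s p / L * (g y' - g x) \<le> \<bar>g y' - g x\<bar>" by simp
      thus ?thesis unfolding h_def B_def by linarith
    qed
    ultimately show False using Fp m ds b[OF p(1)] unfolding F_def by linarith
  qed
  have ev: "\<forall>\<^sub>F p' in nhds p. p' \<in> Z"
  proof -
    have "open {p. 0 < s p \<and> s p < L \<and> norm (q p) < r}"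
      by (intro open_Collect_conj open_Collect_less continuous_intros conts contq)
    moreover have "p \<in> {p. 0 < s p \<and> s p < L \<and> norm (q p) < r}"
      using p(1) 1 2 3 by (auto simp: Z_def)
    ultimately have "\<forall>\<^sub>F p' in nhds p. p' \<in> {p. 0 < s p \<and> s p < L \<and> norm (q p) < r}"
      using eventually_nhds by blast
    thus ?thesis by eventually_elim (auto simp: Z_def)
  qed
  \<comment> \<open>The gradient at \<open>p\<close> of
    \<open>h + \<delta> * s\<^sup>2 - K * (q \<bullet> q)\<close> plus the paraboloid removed from
    \<open>v\<close>, which up to a constant touches \<open>v\<close> from below. Its second
    derivative along \<open>e\<close> is \<open>C + 2 * \<delta>\<close>, more than a supersolution
    with right-hand side \<open>C\<close> permits.\<close>
  define P where "P = C *\<^sub>R p + ((g y' - g x) / L + 2 * \<delta> * s p + 2 * K * s p) *\<^sub>R e - (2 * K) *\<^sub>R (p - x)"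
  have "\<forall>\<^sub>F p' in nhds p. v p + quad_test P e (C + 2 * \<delta>) (2 * K - C) (p' - p) \<le> v p'"
    using ev
  proof eventually_elim
    case (elim p')
    define d where "d = p' - p"
    have p': "p' = p + d" by (simp add: d_def)
    have s': "s p' = s p + e \<bullet> d" by (simp add: s_def d_def inner_diff_right)
    have "F p \<le> F p'" using p(2) elim by blast
    moreover have "h p' = h p + (g y' - g x) / L * (e \<bullet> d)"
      using L by (simp add: h_def s' field_simps)
    moreover have "(s p')\<^sup>2 = (s p)\<^sup>2 + 2 * s p * (e \<bullet> d) + (e \<bullet> d)\<^sup>2"
      by (simp add: s' power2_sum)
    moreover have "q p' \<bullet> q p' = q p \<bullet> q p + 2 * ((p - x) \<bullet> d) - 2 * s p * (e \<bullet> d) + d \<bullet> d - (e \<bullet> d)\<^sup>2"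
      unfolding qq s' unfolding p' by (simp add: inner_add_left inner_add_right inner_diff_left inner_diff_right
          power2_eq_square inner_commute algebra_simps)
    ultimately have "g p + (g y' - g x) / L * (e \<bullet> d) + \<delta> * (2 * s p * (e \<bullet> d) + (e \<bullet> d)\<^sup>2)
      - K * (2 * ((p - x) \<bullet> d) - 2 * s p * (e \<bullet> d) + d \<bullet> d - (e \<bullet> d)\<^sup>2) \<le> g p'"
      by (simp add: F_def algebra_simps)
    moreover have "g p' = v p' - C / 2 * (p \<bullet> p) - C * (p \<bullet> d) - C / 2 * (d \<bullet> d)"
      unfolding g_def p' by (simp add: inner_add_left inner_add_right inner_commute algebra_simps)
    moreover have "g p = v p - C / 2 * (p \<bullet> p)" by (simp add: g_def)
    moreover have "quad_test P e (C + 2 * \<delta>) (2 * K - C) d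
      = C * (p \<bullet> d) + (g y' - g x) / L * (e \<bullet> d) + \<delta> * (2 * s p * (e \<bullet> d) + (e \<bullet> d)\<^sup>2)
      - K * (2 * ((p - x) \<bullet> d) - 2 * s p * (e \<bullet> d) + d \<bullet> d - (e \<bullet> d)\<^sup>2) + C / 2 * (d \<bullet> d)"
      unfolding quad_test_def P_def
      by (simp add: inner_add_left inner_diff_left field_simps)
    ultimately show ?case unfolding d_def by linarith
  qed
  from quad_superD[OF sup _ e this] show False using p(1) \<open>Z \<subseteq> \<Omega>\<close> \<delta> by auto
qed

lemma quad_super_concave:
  fixes v :: "'a::euclidean_space \<Rightarrow> real"
  assumes "open \<Omega>" "convex \<Omega>" "lsc_on \<Omega> v" "quad_super \<Omega> 0 (\<lambda>_. C) v"
  shows "concave_on \<Omega> (\<lambda>x. v x - C / 2 * (x \<bullet> x))"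
  unfolding concave_on_def
proof (rule convex_onI)
  fix t x y assume t: "0 < (t::real)" "t < 1" and x: "x \<in> \<Omega>" and y: "y \<in> \<Omega>"
  let ?g = "\<lambda>x. v x - C / 2 * (x \<bullet> x)"
  have "(1 - t) * ?g x + t * ?g y \<le> ?g ((1 - t) *\<^sub>R x + t *\<^sub>R y)"
  proof (cases "x = y")
    case True
    have "(1 - t) *\<^sub>R y + t *\<^sub>R y = y" by (simp add: scaleR_left_distrib[symmetric])
    moreover have "(1 - t) * a + t * a = a" for a :: real by (simp add: algebra_simps)
    ultimately show ?thesis unfolding True by simp
  next
    case False
    define L where "L = norm (y - x)"
    define e where "e = (y - x) /\<^sub>R L"
    have L: "L > 0" "norm e = 1" using False by (auto simp: L_def e_def)
    have y': "x + L *\<^sub>R e = y" using L by (simp add: e_def)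
    have z': "x + (t * L) *\<^sub>R e = (1 - t) *\<^sub>R x + t *\<^sub>R y"
    proof -
      have "(t * L) *\<^sub>R e = t *\<^sub>R (y - x)" using L by (simp add: e_def)
      thus ?thesis by (simp add: algebra_simps)
    qed
    show ?thesis
      using quad_super_concave_segment[OF assms x _ L(2,1) t] y unfolding y' z' by blast
  qed
  thus "- ?g ((1 - t) *\<^sub>R x + t *\<^sub>R y) \<le> (1 - t) * - ?g x + t * - ?g y" by linarith
qed fact

text \<open>Convex functions on open sets of a Euclidean space are continuous, so semiconcavity
  upgrades lower semicontinuity to continuity.\<close>

lemma quad_super_continuous:
  fixes v :: "'a::euclidean_space \<Rightarrow> real"
  assumes "open \<Omega>" "convex \<Omega>" "lsc_on \<Omega> v" "quad_super \<Omega> 0 (\<lambda>_. C) v"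
  shows "continuous_on \<Omega> v"
proof -
  have "continuous_on \<Omega> (\<lambda>x. - (v x - C / 2 * (x \<bullet> x)))"
    using quad_super_concave[OF assms] assms(1) convex_on_continuous unfolding concave_on_def by blast
  hence "continuous_on \<Omega> (\<lambda>x. - (- (v x - C / 2 * (x \<bullet> x))) + C / 2 * (x \<bullet> x))"
    by (rule continuous_on_add[OF continuous_on_minus]) (intro continuous_intros)
  thus ?thesis by simp
qed

section \<open>Paraboloids touching a supersolution from above\<close>

lemma concave_on_supergradient:
  fixes g :: "'a::euclidean_space \<Rightarrow> real"
  assumes "open S" "x0 \<in> S" "concave_on S g"
  obtains p where "\<And>x. x \<in> S \<Longrightarrow> g x \<le> g x0 + p \<bullet> (x - x0)"
proof -
  \<comment> \<open>The strict hypograph is convex and misses \<open>(x0, g x0)\<close>, so a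
    hyperplane separates them. Its normal is not horizontal, because a nonzero linear function on
    \<open>S\<close> has no maximum at the interior point \<open>x0\<close>; dividing by the
    vertical component \<open>a2\<close> gives the supergradient.\<close>
  let ?A = "{z. fst z \<in> S \<and> snd z < g (fst z)}"
  have cS: "convex S" using assms(3) concave_on_imp_convex by blast
  have "convex ?A"
  proof (rule convexI)
    fix a b :: "'a \<times> real" and u w :: real
    assume a: "a \<in> ?A" and b: "b \<in> ?A" and u: "0 \<le> u" "0 \<le> w" "u + w = 1"
    have "u *\<^sub>R fst a + w *\<^sub>R fst b \<in> S" using a b u cS by (auto simp: convex_def)
    moreover have "u * g (fst a) + w * g (fst b) \<le> g (u *\<^sub>R fst a + w *\<^sub>R fst b)"
      using assms(3) a b u unfolding concave_on_iff by auto
    moreover have "u * snd a + w * snd b < u * g (fst a) + w * g (fst b)"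
    proof (cases "u = 0")
      case True thus ?thesis using b u by simp
    next
      case False thus ?thesis using a b u by (intro add_less_le_mono mult_strict_left_mono mult_left_mono) auto
    qed
    ultimately show "u *\<^sub>R a + w *\<^sub>R b \<in> ?A" by simp
  qed
  moreover have "?A \<noteq> {}" using assms(2) by (auto intro!: exI[of _ x0] exI[of _ "g x0 - 1"])
  moreover have "?A \<inter> {(x0, g x0)} = {}" by auto
  ultimately have "\<exists>a b. a \<noteq> 0 \<and> (\<forall>z\<in>?A. a \<bullet> z \<le> b) \<and> (\<forall>z\<in>{(x0, g x0)}. b \<le> a \<bullet> z)"
    by (intro separating_hyperplane_sets) auto
  then obtain a b where ab: "a \<noteq> 0" "\<And>z. z \<in> ?A \<Longrightarrow> a \<bullet> z \<le> b" "b \<le> a \<bullet> (x0, g x0)"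
    by blast
  define a1 a2 where "a1 = fst a" and "a2 = snd a"
  have le: "a1 \<bullet> x + a2 * t \<le> a1 \<bullet> x0 + a2 * g x0" if "x \<in> S" "t < g x" for x t
    using ab(2)[of "(x, t)"] ab(3) that by (simp add: inner_prod_def a1_def a2_def)
  have "a2 \<ge> 0" using le[of x0 "g x0 - 1"] assms(2) by (simp add: algebra_simps)
  moreover have "a2 \<noteq> 0"
  proof
    assume a2: "a2 = 0"
    hence "a1 \<noteq> 0" using ab(1) by (simp add: a1_def a2_def prod_eq_iff)
    obtain r where r: "r > 0" "ball x0 r \<subseteq> S" using assms(1,2) open_contains_ball by blast
    define x where "x = x0 + (r / 2 / norm a1) *\<^sub>R a1"
    have "x \<in> S" using r \<open>a1 \<noteq> 0\<close> by (intro subsetD[OF r(2)]) (simp add: x_def dist_norm)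
    hence "a1 \<bullet> x \<le> a1 \<bullet> x0" using le[of x "g x - 1"] a2 by simp
    hence "(r / 2 / norm a1) * (a1 \<bullet> a1) \<le> 0" by (simp add: x_def inner_add_right)
    moreover have "(r / 2 / norm a1) * (a1 \<bullet> a1) > 0" using r \<open>a1 \<noteq> 0\<close> by (intro mult_pos_pos) auto
    ultimately show False by simp
  qed
  ultimately have a2: "a2 > 0" by simp
  have "g x \<le> g x0 + (- (1 / a2) *\<^sub>R a1) \<bullet> (x - x0)" if x: "x \<in> S" for x
  proof (rule field_le_epsilon)
    fix d :: real assume "d > 0"
    hence "a2 * (g x - d) \<le> a1 \<bullet> x0 - a1 \<bullet> x + a2 * g x0" using le[OF x, of "g x - d"] by simp
    hence "g x - d \<le> (a1 \<bullet> x0 - a1 \<bullet> x + a2 * g x0) / a2" using a2 by (simp add: pos_le_divide_eq mult.commute)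
    also have "\<dots> = g x0 + (- (1 / a2) *\<^sub>R a1) \<bullet> (x - x0)" using a2 by (simp add: field_simps inner_diff_right)
    finally show "g x \<le> g x0 + (- (1 / a2) *\<^sub>R a1) \<bullet> (x - x0) + d" by simp
  qed
  thus ?thesis using that by blast
qed

text \<open>With \<nu> = 0 this freezes the zero-order term into a bound on second derivatives,
  valid wherever \<open>f x - \<mu> * v x\<close> is at most a constant.\<close>

lemma quad_super_mono:
  assumes "quad_super \<Omega> \<mu> f v" "\<Omega>' \<subseteq> \<Omega>" "\<And>x. x \<in> \<Omega>' \<Longrightarrow> f x - \<mu> * v x \<le> g x - \<nu> * v x"
  shows "quad_super \<Omega>' \<nu> g v"
  unfolding quad_super_def
proof (intro ballI allI impI)
  fix x0 p e l K
  assume "x0 \<in> \<Omega>'" "norm e = 1" "\<forall>\<^sub>F x in nhds x0. v x0 + quad_test p e l K (x - x0) \<le> v x"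
  hence "l + \<mu> * v x0 \<le> f x0" using assms(2) by (intro quad_superD[OF assms(1)]) auto
  thus "l + \<nu> * v x0 \<le> g x0" using assms(3)[OF \<open>x0 \<in> \<Omega>'\<close>] by linarith
qed

text \<open>By continuity \<open>f - \<mu> v < c\<close> on a ball around \<open>x0\<close>, so
  \<open>v - c / 2 * (x \<bullet> x)\<close> is concave there. Its supergradient at
  \<open>x0\<close>, corrected by \<open>c *\<^sub>R x0\<close> for recentring the paraboloid, is
  the required \<open>p\<close>.\<close>

lemma quad_super_touch_above:
  fixes v :: "'a::euclidean_space \<Rightarrow> real"
  assumes "open \<Omega>" "continuous_on \<Omega> v" "continuous_on \<Omega> f" "quad_super \<Omega> \<mu> f v"
    and x0: "x0 \<in> \<Omega>" and c: "f x0 - \<mu> * v x0 < c"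
  obtains p where "\<forall>\<^sub>F x in nhds x0. v x \<le> v x0 + p \<bullet> (x - x0) + c / 2 * ((x - x0) \<bullet> (x - x0))"
proof -
  have "continuous_on \<Omega> (\<lambda>x. f x - \<mu> * v x)" by (intro continuous_intros assms)
  hence "\<forall>\<^sub>F x in nhds x0. x \<in> \<Omega> \<and> f x - \<mu> * v x < c"
    using assms(1) x0 c by (intro continuous_on_eventually_order(1)) auto
  then obtain r where r: "r > 0" "\<And>x. dist x x0 < r \<Longrightarrow> x \<in> \<Omega> \<and> f x - \<mu> * v x < c"
    unfolding eventually_nhds_metric by blast
  let ?B = "ball x0 r"
  have sub: "?B \<subseteq> \<Omega>" using r by (auto simp: dist_commute)
  have "quad_super ?B 0 (\<lambda>_. c) v"
    using assms(4) sub by (rule quad_super_mono) (use r(2) in \<open>force simp: dist_commute\<close>)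
  hence "concave_on ?B (\<lambda>x. v x - c / 2 * (x \<bullet> x))"
    using sub assms(2) by (intro quad_super_concave continuous_on_imp_lsc_on) (auto intro: continuous_on_subset)
  then obtain p where p: "\<And>x. x \<in> ?B \<Longrightarrow> v x - c / 2 * (x \<bullet> x) \<le> v x0 - c / 2 * (x0 \<bullet> x0) + p \<bullet> (x - x0)"
    using concave_on_supergradient[of ?B x0] r(1) by auto
  have "v x \<le> v x0 + (p + c *\<^sub>R x0) \<bullet> (x - x0) + c / 2 * ((x - x0) \<bullet> (x - x0))" if "dist x x0 < r" for x
    using p[of x] that
    by (simp add: dist_commute inner_diff_left inner_diff_right inner_add_left inner_add_right inner_commute field_simps)
  thus ?thesis using that r(1) unfolding eventually_nhds_metric by blast
qed

section \<open>Comparison and infima of supersolutions\<close>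

text \<open>Recentres a test function without changing \<open>e\<close>, \<open>l\<close> and
  \<open>K\<close>; needed when a perturbed contact point differs from the original one.\<close>

lemma quad_test_shift:
  "quad_test p e l K (a + d) =
   quad_test p e l K a + quad_test (p + ((l + K) * (e \<bullet> a)) *\<^sub>R e - K *\<^sub>R a) e l K d"
  unfolding quad_test_def
  by (simp add: inner_add_left inner_add_right inner_diff_left inner_diff_right power2_eq_square inner_commute field_simps)

text \<open>Adding the inequalities at two points symmetric about \<open>x0\<close> cancels the
  gradient and leaves only the curvature along \<open>e\<close>.\<close>

lemma quad_test_second_difference:
  fixes g :: "'a::real_inner \<Rightarrow> real"
  assumes "\<forall>\<^sub>F x in nhds x0. a + quad_test p e l K (x - x0) \<le> g x" "norm e = 1"
  obtains r where "r > 0" "\<And>s. \<bar>s\<bar> < r \<Longrightarrow> 2 * a + l * s\<^sup>2 \<le> g (x0 + s *\<^sub>R e) + g (x0 - s *\<^sub>R e)"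
proof -
  obtain r where r: "r > 0" "\<And>x. dist x x0 < r \<Longrightarrow> a + quad_test p e l K (x - x0) \<le> g x"
    using assms(1) unfolding eventually_nhds_metric by blast
  have ee: "e \<bullet> e = 1" using assms(2) by (simp add: dot_square_norm)
  have q: "quad_test p e l K (s *\<^sub>R e) = s * (p \<bullet> e) + l / 2 * s\<^sup>2" for s
    by (simp add: quad_test_def ee power2_eq_square)
  have "2 * a + l * s\<^sup>2 \<le> g (x0 + s *\<^sub>R e) + g (x0 - s *\<^sub>R e)" if "\<bar>s\<bar> < r" for s
    using r(2)[of "x0 + s *\<^sub>R e"] r(2)[of "x0 + (- s) *\<^sub>R e"] that assms(2) q[of s] q[of "- s"]
    by (simp add: dist_norm)
  thus ?thesis using that r(1) by blast
qed

lemma quad_above_second_difference: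
  fixes g :: "'a::real_inner \<Rightarrow> real"
  assumes "\<forall>\<^sub>F x in nhds x0. g x \<le> a + p \<bullet> (x - x0) + c / 2 * ((x - x0) \<bullet> (x - x0))" "norm e = 1"
  obtains r where "r > 0" "\<And>s. \<bar>s\<bar> < r \<Longrightarrow> g (x0 + s *\<^sub>R e) + g (x0 - s *\<^sub>R e) \<le> 2 * a + c * s\<^sup>2"
proof -
  obtain r where r: "r > 0" "\<And>x. dist x x0 < r \<Longrightarrow> g x \<le> a + p \<bullet> (x - x0) + c / 2 * ((x - x0) \<bullet> (x - x0))"
    using assms(1) unfolding eventually_nhds_metric by blast
  have ee: "e \<bullet> e = 1" using assms(2) by (simp add: dot_square_norm)
  have "g (x0 + s *\<^sub>R e) + g (x0 - s *\<^sub>R e) \<le> 2 * a + c * s\<^sup>2" if "\<bar>s\<bar> < r" for s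
    using r(2)[of "x0 + s *\<^sub>R e"] r(2)[of "x0 + (- s) *\<^sub>R e"] that assms(2)
    by (simp add: dist_norm ee power2_eq_square)
  thus ?thesis using that r(1) by blast
qed

text \<open>Along the unit vector \<open>e\<close> the paraboloid has second difference exactly
  \<open>c * s\<^sup>2\<close>, while the test function forces at least
  \<open>l * s\<^sup>2\<close>.\<close>

lemma quad_test_below_isotropic:
  fixes p z :: "'a::real_inner" and a c :: real
  defines "b \<equiv> \<lambda>x. a + p \<bullet> (x - z) + c / 2 * ((x - z) \<bullet> (x - z))"
  assumes "\<forall>\<^sub>F x in nhds x0. b x0 + quad_test p' e l K (x - x0) \<le> b x" "norm e = 1"
  shows "l \<le> c"
proof -
  have ee: "e \<bullet> e = 1" using assms(3) by (simp add: dot_square_norm)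
  obtain r where r: "r > 0" "\<And>s. \<bar>s\<bar> < r \<Longrightarrow> 2 * b x0 + l * s\<^sup>2 \<le> b (x0 + s *\<^sub>R e) + b (x0 - s *\<^sub>R e)"
    using quad_test_second_difference[OF assms(2,3)] by blast
  define s where "s = r / 2"
  have s: "\<bar>s\<bar> < r" "s > 0" using r(1) by (auto simp: s_def)
  have "b (x0 + s *\<^sub>R e) + b (x0 - s *\<^sub>R e) = 2 * b x0 + c * s\<^sup>2"
    unfolding b_def by (simp add: inner_add_left inner_add_right inner_diff_left inner_diff_right ee
        power2_eq_square inner_commute field_simps)
  hence "l * s\<^sup>2 \<le> c * s\<^sup>2" using r(2)[OF s(1)] by linarith
  thus ?thesis using s(2) by simp
qed

lemma quad_super_cong:
  assumes "open \<Omega>" "\<And>x. x \<in> \<Omega> \<Longrightarrow> v x = v' x" "quad_super \<Omega> \<mu> f v"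
  shows "quad_super \<Omega> \<mu> f v'"
  unfolding quad_super_def
proof (intro ballI allI impI)
  fix x0 p e l K
  assume x0: "x0 \<in> \<Omega>" and e: "norm e = 1" and t: "\<forall>\<^sub>F x in nhds x0. v' x0 + quad_test p e l K (x - x0) \<le> v' x"
  have "\<forall>\<^sub>F x in nhds x0. x \<in> \<Omega>" using assms(1) x0 eventually_nhds by blast
  with t have "\<forall>\<^sub>F x in nhds x0. v x0 + quad_test p e l K (x - x0) \<le> v x"
    by eventually_elim (use assms(2) x0 in auto)
  from quad_superD[OF assms(3) x0 e this] show "l + \<mu> * v' x0 \<le> f x0" using assms(2) x0 by simp
qed

lemma quad_sub_cong:
  assumes "open \<Omega>" "\<And>x. x \<in> \<Omega> \<Longrightarrow> v x = v' x" "quad_sub \<Omega> \<mu> f v"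
  shows "quad_sub \<Omega> \<mu> f v'"
  unfolding quad_sub_def
proof (intro ballI allI impI)
  fix x0 p c
  assume x0: "x0 \<in> \<Omega>" and t: "\<forall>\<^sub>F x in nhds x0. v' x \<le> v' x0 + p \<bullet> (x - x0) + c / 2 * ((x - x0) \<bullet> (x - x0))"
  have "\<forall>\<^sub>F x in nhds x0. x \<in> \<Omega>" using assms(1) x0 eventually_nhds by blast
  with t have "\<forall>\<^sub>F x in nhds x0. v x \<le> v x0 + p \<bullet> (x - x0) + c / 2 * ((x - x0) \<bullet> (x - x0))"
    by eventually_elim (use assms(2) x0 in auto)
  from quad_subD[OF assms(3) x0 this] show "f x0 \<le> c + \<mu> * v' x0" using assms(2) x0 by simp
qed

text \<open>If the maximum \<open>t\<close> of \<open>(u - v) / \<phi>\<close> is positive, then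
  \<open>v + t \<phi>\<close> touches \<open>u\<close> from above at a point of \<Omega>.
  Paraboloids above \<open>v\<close> and above \<phi> combine into a test for \<open>u\<close>,
  which the gap between \<mu> and \<mu>' rules out.\<close>

lemma comparison:
  fixes \<Omega> :: "'a::euclidean_space set"
  assumes op: "open \<Omega>" and bd: "bounded \<Omega>" and f: "continuous_on \<Omega> f"
    and u: "continuous_on (closure \<Omega>) u" "quad_sub \<Omega> \<mu> f u"
    and v: "continuous_on (closure \<Omega>) v" "quad_super \<Omega> \<mu> f v"
    and \<phi>: "continuous_on (closure \<Omega>) \<phi>" "quad_super \<Omega> \<mu>' (\<lambda>_. 0) \<phi>" "\<And>x. x \<in> closure \<Omega> \<Longrightarrow> \<phi> x > 0"
    and \<mu>: "\<mu> < \<mu>'" and fr: "\<And>x. x \<in> frontier \<Omega> \<Longrightarrow> u x \<le> v x"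
    and x: "x \<in> closure \<Omega>"
  shows "u x \<le> v x"
proof (rule ccontr)
  assume nle: "\<not> u x \<le> v x"
  let ?q = "\<lambda>x. (u x - v x) / \<phi> x"
  have "compact (closure \<Omega>)" using bd by simp
  moreover have "continuous_on (closure \<Omega>) ?q"
    using \<phi>(3) by (intro continuous_intros u v \<phi>) force
  ultimately have "\<exists>x0\<in>closure \<Omega>. \<forall>y\<in>closure \<Omega>. ?q y \<le> ?q x0"
    using x by (intro continuous_attains_sup) auto
  then obtain x0 where x0: "x0 \<in> closure \<Omega>" "\<And>y. y \<in> closure \<Omega> \<Longrightarrow> ?q y \<le> ?q x0" by blast
  define t where "t = ?q x0"
  have "0 < ?q x" using nle \<phi>(3)[OF x] by simp
  hence t: "t > 0" using x0(2)[OF x] by (simp add: t_def)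
  have le: "u y \<le> v y + t * \<phi> y" if "y \<in> closure \<Omega>" for y
    using x0(2)[OF that] \<phi>(3)[OF that] unfolding t_def[symmetric] by (simp add: pos_divide_le_eq)
  have eq: "u x0 = v x0 + t * \<phi> x0" using \<phi>(3)[OF x0(1)] by (simp add: t_def)
  have "0 < t * \<phi> x0" using t \<phi>(3)[OF x0(1)] by simp
  hence "x0 \<notin> frontier \<Omega>" using fr[of x0] eq by linarith
  hence x0': "x0 \<in> \<Omega>" using x0(1) op by (simp add: frontier_def interior_open)
  have sub: "\<Omega> \<subseteq> closure \<Omega>" by (rule closure_subset)
  \<comment> \<open>The strictness gained from \<open>\<mu> < \<mu>'\<close>. Each of the two
    paraboloids spends a third of it on its excess Hessian.\<close>
  define d where "d = t * (\<mu>' - \<mu>) * \<phi> x0"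
  have d: "d > 0" using t \<mu> \<phi>(3)[OF x0(1)] by (simp add: d_def)
  define c1 where "c1 = f x0 - \<mu> * v x0 + d / 3"
  define c2 where "c2 = - \<mu>' * \<phi> x0 + d / (3 * t)"
  obtain p1 where p1: "\<forall>\<^sub>F x in nhds x0. v x \<le> v x0 + p1 \<bullet> (x - x0) + c1 / 2 * ((x - x0) \<bullet> (x - x0))"
    using quad_super_touch_above[OF op continuous_on_subset[OF v(1) sub] f v(2) x0', of c1] d by (auto simp: c1_def)
  have "0 - \<mu>' * \<phi> x0 < c2" using d t by (simp add: c2_def)
  then obtain p2 where p2: "\<forall>\<^sub>F x in nhds x0. \<phi> x \<le> \<phi> x0 + p2 \<bullet> (x - x0) + c2 / 2 * ((x - x0) \<bullet> (x - x0))"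
    using quad_super_touch_above[OF op continuous_on_subset[OF \<phi>(1) sub] continuous_on_const \<phi>(2) x0', of c2] by auto
  have "\<forall>\<^sub>F x in nhds x0. x \<in> \<Omega>" using op x0' eventually_nhds by blast
  with p1 p2 have "\<forall>\<^sub>F x in nhds x0. u x \<le> u x0 + (p1 + t *\<^sub>R p2) \<bullet> (x - x0) + (c1 + t * c2) / 2 * ((x - x0) \<bullet> (x - x0))"
  proof eventually_elim
    case (elim x)
    have "u x \<le> v x + t * \<phi> x" using le elim sub by blast
    also have "\<dots> \<le> v x0 + p1 \<bullet> (x - x0) + c1 / 2 * ((x - x0) \<bullet> (x - x0))
       + t * (\<phi> x0 + p2 \<bullet> (x - x0) + c2 / 2 * ((x - x0) \<bullet> (x - x0)))"
      using elim t by (intro add_mono mult_left_mono) auto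
    also have "\<dots> = u x0 + (p1 + t *\<^sub>R p2) \<bullet> (x - x0) + (c1 + t * c2) / 2 * ((x - x0) \<bullet> (x - x0))"
      unfolding eq by (simp add: inner_add_left distrib_left distrib_right add_divide_distrib)
    finally show ?case .
  qed
  from quad_subD[OF u(2) x0' this]
  have "f x0 \<le> c1 + t * c2 + \<mu> * u x0" .
  moreover have "t * c2 = - t * \<mu>' * \<phi> x0 + d / 3" using t by (simp add: c2_def field_simps)
  moreover have "\<mu> * u x0 = \<mu> * v x0 + t * \<mu> * \<phi> x0" by (simp add: eq algebra_simps)
  moreover have "d = t * \<mu>' * \<phi> x0 - t * \<mu> * \<phi> x0" by (simp add: d_def algebra_simps)
  ultimately show False using d c1_def by linarith
qed

text \<open>The infimum need not be attained, so the test function is lowered by \<eta> |x - x0|^2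
  to make the contact strict. A member of \<open>F\<close> almost minimal at \<open>x0\<close> then
  has a vertical translate of it touching from below at a nearby \<open>x1\<close>, where that
  member's inequality contradicts the assumed violation.\<close>

lemma quad_super_INF:
  fixes \<Omega> :: "'a::euclidean_space set"
  assumes op: "open \<Omega>" and f: "continuous_on \<Omega> f" and ne: "F \<noteq> {}"
    and F: "\<And>v. v \<in> F \<Longrightarrow> continuous_on \<Omega> v" "\<And>v. v \<in> F \<Longrightarrow> quad_super \<Omega> \<mu> f v"
    and m: "\<And>v x. v \<in> F \<Longrightarrow> x \<in> \<Omega> \<Longrightarrow> m \<le> v x"
  defines "u \<equiv> \<lambda>x. INF v\<in>F. v x"
  shows "quad_super \<Omega> \<mu> f u"
  unfolding quad_super_def
proof (intro ballI allI impI, rule ccontr)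
  fix x0 p e l K
  assume x0: "x0 \<in> \<Omega>" and e: "norm e = 1"
    and t: "\<forall>\<^sub>F x in nhds x0. u x0 + quad_test p e l K (x - x0) \<le> u x"
    and neg: "\<not> l + \<mu> * u x0 \<le> f x0"
  have bdd: "bdd_below ((\<lambda>v. v x) ` F)" if "x \<in> \<Omega>" for x
    using m that by (auto intro!: bdd_belowI)
  \<comment> \<open>The violation is spent as follows: half on lowering the curvature by
    \<open>2 * \<eta>\<close>, a quarter on the change of the zero-order term, an eighth on the
    change of \<open>f\<close>.\<close>
  define gap where "gap = l + \<mu> * u x0 - f x0"
  have gap: "gap > 0" using neg by (simp add: gap_def)
  define \<eta> where "\<eta> = gap / 4"
  have \<eta>: "\<eta> > 0" using gap by (simp add: \<eta>_def)
  define \<sigma> where "\<sigma> = gap / (8 * (1 + \<bar>\<mu>\<bar>))"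
  have \<sigma>: "\<sigma> > 0" "\<bar>\<mu>\<bar> * \<sigma> \<le> gap / 8"
    using gap by (auto simp: \<sigma>_def field_simps add_pos_nonneg)
  define q where "q = (\<lambda>x. quad_test p e (l - 2 * \<eta>) (K + 2 * \<eta>) (x - x0))"
  have q: "quad_test p e l K (x - x0) = q x + \<eta> * ((x - x0) \<bullet> (x - x0))" for x
    by (simp add: q_def quad_test_def field_simps)
  have cq: "continuous_on UNIV q" unfolding q_def quad_test_def by (intro continuous_intros)
  have q0: "q x0 = 0" by (simp add: q_def quad_test_def)
  have "\<forall>\<^sub>F x in nhds x0. x \<in> \<Omega> \<and> f x < f x0 + gap / 8"
    using continuous_on_eventually_order(1)[OF op f x0] gap by simp
  moreover have "\<forall>\<^sub>F x in nhds x0. x \<in> UNIV \<and> q x < \<sigma>"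
    by (rule continuous_on_eventually_order(1)[OF open_UNIV cq]) (use \<sigma> q0 in auto)
  moreover have "\<forall>\<^sub>F x in nhds x0. x \<in> UNIV \<and> - \<sigma> < q x"
    by (rule continuous_on_eventually_order(2)[OF open_UNIV cq]) (use \<sigma> q0 in auto)
  ultimately have "\<forall>\<^sub>F x in nhds x0. x \<in> \<Omega> \<and> f x < f x0 + gap / 8 \<and> q x < \<sigma> \<and> - \<sigma> < q x
      \<and> u x0 + q x + \<eta> * ((x - x0) \<bullet> (x - x0)) \<le> u x"
    using t by eventually_elim (simp add: q)
  then obtain r where r: "r > 0" "\<And>x. dist x x0 < r \<Longrightarrow> x \<in> \<Omega> \<and> f x < f x0 + gap / 8 \<and> q x < \<sigma> \<and> - \<sigma> < q x
      \<and> u x0 + q x + \<eta> * ((x - x0) \<bullet> (x - x0)) \<le> u x"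
    unfolding eventually_nhds_metric by blast
  define \<rho> where "\<rho> = r / 2"
  have \<rho>: "0 < \<rho>" "\<rho> < r" using r(1) by (auto simp: \<rho>_def)
  \<comment> \<open>The bound by \<sigma> keeps \<open>v x1\<close> within
    \<open>2 * \<sigma>\<close> of \<open>u x0\<close>; the other one keeps \<open>x1\<close> off
    the boundary sphere.\<close>
  define \<kappa> where "\<kappa> = min \<sigma> (\<eta> * \<rho>\<^sup>2 / 2)"
  have \<kappa>: "\<kappa> > 0" using \<sigma> \<eta> \<rho> by (simp add: \<kappa>_def)
  have "(INF v\<in>F. v x0) < u x0 + \<kappa>" using \<kappa> by (simp add: u_def)
  then obtain v where v: "v \<in> F" "v x0 < u x0 + \<kappa>"
    using cINF_less_iff[OF ne bdd[OF x0]] by blast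
  have inB: "x \<in> \<Omega>" if "x \<in> cball x0 \<rho>" for x
    using r(2)[of x] that \<rho> by (simp add: dist_commute)
  have "continuous_on (cball x0 \<rho>) (\<lambda>x. v x - q x)"
    using inB by (intro continuous_intros continuous_on_subset[OF F(1)[OF v(1)]] continuous_on_subset[OF cq]) auto
  then obtain x1 where x1: "x1 \<in> cball x0 \<rho>" "\<And>x. x \<in> cball x0 \<rho> \<Longrightarrow> v x1 - q x1 \<le> v x - q x"
    using continuous_attains_inf[of "cball x0 \<rho>" "\<lambda>x. v x - q x"] \<rho> by auto
  have x1r: "dist x1 x0 < r" using x1(1) \<rho> by (simp add: dist_commute)
  note P = r(2)[OF x1r]
  have a: "v x1 - q x1 < u x0 + \<kappa>" using x1(2)[of x0] v(2) q0 \<rho> by simp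
  have b: "u x1 \<le> v x1" unfolding u_def using P v(1) by (intro cINF_lower bdd) auto
  have "\<eta> * ((x1 - x0) \<bullet> (x1 - x0)) < \<eta> * \<rho>\<^sup>2 / 2"
  proof -
    have "\<kappa> \<le> \<eta> * \<rho>\<^sup>2 / 2" by (simp add: \<kappa>_def)
    thus ?thesis using a b P by linarith
  qed
  also have "\<dots> < \<eta> * \<rho>\<^sup>2" using \<eta> \<rho> by simp
  finally have "(norm (x1 - x0))\<^sup>2 < \<rho>\<^sup>2" using \<eta> by (simp add: dot_square_norm)
  hence x1\<rho>: "dist x1 x0 < \<rho>" using \<rho> by (simp add: power2_less_imp_less dist_norm)
  hence "\<forall>\<^sub>F x in nhds x1. x \<in> ball x0 \<rho>" using eventually_nhds[of _ x1] by (metis dist_commute mem_ball open_ball)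
  hence "\<forall>\<^sub>F x in nhds x1. v x1 + quad_test (p + (((l - 2 * \<eta>) + (K + 2 * \<eta>)) * (e \<bullet> (x1 - x0))) *\<^sub>R e - (K + 2 * \<eta>) *\<^sub>R (x1 - x0))
       e (l - 2 * \<eta>) (K + 2 * \<eta>) (x - x1) \<le> v x"
  proof eventually_elim
    case (elim x)
    have "v x1 - q x1 \<le> v x - q x" using x1(2) elim by simp
    moreover have "q x = quad_test p e (l - 2 * \<eta>) (K + 2 * \<eta>) ((x1 - x0) + (x - x1))"
      by (simp add: q_def)
    ultimately show ?case unfolding quad_test_shift q_def by simp
  qed
  hence "(l - 2 * \<eta>) + \<mu> * v x1 \<le> f x1"
    using P by (intro quad_superD[OF F(2)[OF v(1)] _ e]) auto
  moreover have "\<bar>v x1 - u x0\<bar> \<le> 2 * \<sigma>"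
  proof -
    have "0 \<le> \<eta> * ((x1 - x0) \<bullet> (x1 - x0))" using \<eta> by simp
    moreover have "\<kappa> \<le> \<sigma>" by (simp add: \<kappa>_def)
    ultimately show ?thesis using a b P by linarith
  qed
  hence "\<bar>\<mu> * (v x1 - u x0)\<bar> \<le> gap / 4"
    using mult_left_mono[of "\<bar>v x1 - u x0\<bar>" "2 * \<sigma>" "\<bar>\<mu>\<bar>"] \<sigma>(2) by (simp add: abs_mult)
  hence "\<mu> * u x0 - gap / 4 \<le> \<mu> * v x1"
    using abs_le_D2 by (fastforce simp: right_diff_distrib)
  moreover have "2 * \<eta> = gap / 2" by (simp add: \<eta>_def)
  moreover have "f x1 < f x0 + gap / 8" using P by blast
  ultimately show False using gap gap_def by linarith
qed

text \<open>An infimum of concave functions is concave, and the paraboloid with the common constant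
  \<open>C\<close> may be subtracted before the infimum is taken. Concavity on an open set gives
  continuity.\<close>

lemma INF_semiconcave_continuous:
  fixes \<Omega> :: "'a::euclidean_space set"
  assumes op: "open \<Omega>" and cv: "convex \<Omega>" and ne: "F \<noteq> {}"
    and F: "\<And>v. v \<in> F \<Longrightarrow> concave_on \<Omega> (\<lambda>x. v x - C / 2 * (x \<bullet> x))"
    and m: "\<And>v x. v \<in> F \<Longrightarrow> x \<in> \<Omega> \<Longrightarrow> m \<le> v x"
  shows "continuous_on \<Omega> (\<lambda>x. INF v\<in>F. v x)"
proof -
  define u where "u = (\<lambda>x. INF v\<in>F. v x)"
  let ?h = "\<lambda>x::'a. C / 2 * (x \<bullet> x)"
  have bdd: "bdd_below ((\<lambda>v. v x) ` F)" if "x \<in> \<Omega>" for x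
    using m that by (auto intro!: bdd_belowI)
  have "convex_on \<Omega> (\<lambda>x. - (u x - ?h x))"
  proof (rule convex_onI)
    fix t x y assume t: "0 < (t::real)" "t < 1" and x: "x \<in> \<Omega>" and y: "y \<in> \<Omega>"
    let ?z = "(1 - t) *\<^sub>R x + t *\<^sub>R y"
    have "(1 - t) * (u x - ?h x) + t * (u y - ?h y) + ?h ?z \<le> u ?z" unfolding u_def
    proof (rule cINF_greatest[OF ne])
      fix v assume v: "v \<in> F"
      have "(1 - t) * (v x - ?h x) + t * (v y - ?h y) \<le> v ?z - ?h ?z"
        using F[OF v] t x y unfolding concave_on_iff by auto
      moreover have "(1 - t) * ((INF v\<in>F. v x) - ?h x) \<le> (1 - t) * (v x - ?h x)"
        using t v by (intro mult_left_mono diff_right_mono cINF_lower bdd x) auto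
      moreover have "t * ((INF v\<in>F. v y) - ?h y) \<le> t * (v y - ?h y)"
        using t v by (intro mult_left_mono diff_right_mono cINF_lower bdd y) auto
      ultimately show "(1 - t) * ((INF v\<in>F. v x) - ?h x) + t * ((INF v\<in>F. v y) - ?h y) + ?h ?z \<le> v ?z"
        by linarith
    qed
    thus "- (u ?z - ?h ?z) \<le> (1 - t) * - (u x - ?h x) + t * - (u y - ?h y)" by linarith
  qed (rule cv)
  hence "continuous_on \<Omega> (\<lambda>x. - (u x - ?h x))" using op convex_on_continuous by blast
  hence "continuous_on \<Omega> (\<lambda>x. - (- (u x - ?h x)) + ?h x)"
    by (rule continuous_on_add[OF continuous_on_minus]) (intro continuous_intros)
  thus ?thesis unfolding u_def by simp
qed

section \<open>Perron's method\<close>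

text \<open>The lowering step of Perron's method. Where \<open>u\<close> fails to be a subsolution,
  the touching paraboloid, bent upwards by \<eta> and pushed down by \<kappa>, is still a
  supersolution near \<open>x0\<close>, and so is its minimum with \<open>u\<close>.\<close>

lemma quad_super_bump:
  fixes \<Omega> :: "'a::euclidean_space set"
  assumes op: "open \<Omega>" and f: "continuous_on \<Omega> f" and u: "continuous_on \<Omega> u" "quad_super \<Omega> \<mu> f u"
    and w: "continuous_on \<Omega> w" "quad_sub \<Omega> \<mu> f w" and wu: "\<And>x. x \<in> \<Omega> \<Longrightarrow> w x \<le> u x"
    and x0: "x0 \<in> \<Omega>"
    and t: "\<forall>\<^sub>F x in nhds x0. u x \<le> u x0 + p \<bullet> (x - x0) + c / 2 * ((x - x0) \<bullet> (x - x0))"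
    and lt: "c + \<mu> * u x0 < f x0"
  obtains v where "continuous_on \<Omega> v" "quad_super \<Omega> \<mu> f v" "\<And>x. x \<in> \<Omega> \<Longrightarrow> w x \<le> v x"
    "\<And>x. x \<in> \<Omega> \<Longrightarrow> v x \<le> u x" "v x0 < u x0"
proof -
  have ev\<Omega>: "\<forall>\<^sub>F x in nhds x0. x \<in> \<Omega>" using op x0 eventually_nhds by blast
  \<comment> \<open>If \<open>w\<close> met \<open>u\<close> at \<open>x0\<close>, the paraboloid
    would also touch \<open>w\<close> from above and contradict the subsolution property of
    \<open>w\<close>.\<close>
  have wlt: "w x0 < u x0"
  proof (rule ccontr)
    assume "\<not> w x0 < u x0"
    hence eq: "w x0 = u x0" using wu[OF x0] by simp
    have "\<forall>\<^sub>F x in nhds x0. w x \<le> w x0 + p \<bullet> (x - x0) + c / 2 * ((x - x0) \<bullet> (x - x0))"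
      using t ev\<Omega> by eventually_elim (use wu eq in force)
    from quad_subD[OF w(2) x0 this] show False using lt eq by simp
  qed
  define gap where "gap = f x0 - c - \<mu> * u x0"
  have gap: "gap > 0" using lt by (simp add: gap_def)
  define \<eta> where "\<eta> = gap / 4"
  have \<eta>: "\<eta> > 0" using gap by (simp add: \<eta>_def)
  define \<sigma> where "\<sigma> = gap / (8 * (1 + \<bar>\<mu>\<bar>))"
  have \<sigma>: "\<sigma> > 0" "\<bar>\<mu>\<bar> * \<sigma> \<le> gap / 8"
    using gap by (auto simp: \<sigma>_def field_simps add_pos_nonneg)
  define \<kappa>0 where "\<kappa>0 = (u x0 - w x0) / 4"
  have \<kappa>0: "\<kappa>0 > 0" "u x0 = w x0 + 4 * \<kappa>0" using wlt by (auto simp: \<kappa>0_def field_simps)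
  define c' where "c' = c + 2 * \<eta>"
  define b where "b = (\<lambda>x. u x0 + p \<bullet> (x - x0) + c' / 2 * ((x - x0) \<bullet> (x - x0)))"
  have b0: "b x0 = u x0" by (simp add: b_def)
  have cb: "continuous_on A b" for A unfolding b_def by (intro continuous_intros)
  define \<sigma>' where "\<sigma>' = min \<sigma> \<kappa>0"
  have \<sigma>': "\<sigma>' > 0" "\<sigma>' \<le> \<sigma>" "\<sigma>' \<le> \<kappa>0" using \<sigma> \<kappa>0 by (auto simp: \<sigma>'_def)
  have "\<forall>\<^sub>F x in nhds x0. x \<in> \<Omega> \<and> f x0 - gap / 8 < f x"
    using continuous_on_eventually_order(2)[OF op f x0] gap by simp
  moreover have "\<forall>\<^sub>F x in nhds x0. x \<in> \<Omega> \<and> w x < w x0 + \<kappa>0"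
    using continuous_on_eventually_order(1)[OF op w(1) x0] \<kappa>0 by simp
  moreover have "\<forall>\<^sub>F x in nhds x0. x \<in> \<Omega> \<and> b x < u x0 + \<sigma>'"
    using continuous_on_eventually_order(1)[OF op cb x0] \<sigma>' b0 by simp
  moreover have "\<forall>\<^sub>F x in nhds x0. x \<in> \<Omega> \<and> u x0 - \<sigma>' < b x"
    using continuous_on_eventually_order(2)[OF op cb x0] \<sigma>' b0 by simp
  ultimately have "\<forall>\<^sub>F x in nhds x0. x \<in> \<Omega> \<and> f x0 - gap / 8 < f x \<and> w x < w x0 + \<kappa>0
     \<and> b x < u x0 + \<sigma>' \<and> u x0 - \<sigma>' < b x \<and> u x + \<eta> * ((x - x0) \<bullet> (x - x0)) \<le> b x"
    using t by eventually_elim (auto simp: b_def c'_def field_simps)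
  then obtain r where r: "r > 0" "\<And>x. dist x x0 < r \<Longrightarrow> x \<in> \<Omega> \<and> f x0 - gap / 8 < f x \<and> w x < w x0 + \<kappa>0
     \<and> b x < u x0 + \<sigma>' \<and> u x0 - \<sigma>' < b x \<and> u x + \<eta> * ((x - x0) \<bullet> (x - x0)) \<le> b x"
    unfolding eventually_nhds_metric by blast
  define \<rho> where "\<rho> = r / 2"
  have \<rho>: "0 < \<rho>" "\<rho> < r" using r(1) by (auto simp: \<rho>_def)
  \<comment> \<open>Beyond distance \<open>\<rho> / 2\<close> from \<open>x0\<close> the paraboloid
    exceeds \<open>u\<close> by at least \<open>\<eta> * \<rho>\<^sup>2 / 4\<close>, so lowering it
    by \<kappa> leaves \<open>u\<close> as the minimum and the two formulas for \<open>v\<close>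
    agree on an annulus. \<open>\<kappa> \<le> \<sigma>'\<close> keeps \<open>v\<close> above
    \<open>w\<close>.\<close>
  define \<kappa> where "\<kappa> = min \<sigma>' (\<eta> * \<rho>\<^sup>2 / 8)"
  have \<kappa>: "\<kappa> > 0" "\<kappa> \<le> \<sigma>'" "\<kappa> \<le> \<eta> * \<rho>\<^sup>2 / 8" using \<sigma>' \<eta> \<rho> by (auto simp: \<kappa>_def)
  define v where "v = (\<lambda>x. if dist x x0 < \<rho> then min (u x) (b x - \<kappa>) else u x)"
  have vu: "v x \<le> u x" for x by (simp add: v_def)
  have wv: "w x \<le> v x" if "x \<in> \<Omega>" for x
  proof (cases "dist x x0 < \<rho>")
    case True
    hence "w x \<le> b x - \<kappa>" using r(2)[of x] \<rho> \<kappa> \<sigma>' \<kappa>0 by simp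
    thus ?thesis using wu[OF that] by (simp add: v_def)
  qed (simp add: v_def wu that)
  have out: "v x = u x" if "\<rho> / 2 < dist x x0" for x
  proof (cases "dist x x0 < \<rho>")
    case True
    have "(\<rho> / 2)\<^sup>2 \<le> (norm (x - x0))\<^sup>2" using that \<rho> by (intro power_mono) (auto simp: dist_norm)
    hence "\<eta> * (\<rho>\<^sup>2 / 4) \<le> \<eta> * ((x - x0) \<bullet> (x - x0))" 
      using \<eta> by (intro mult_left_mono) (auto simp: dot_square_norm power_divide)
    moreover have "\<eta> * \<rho>\<^sup>2 \<ge> 0" using \<eta> by simp
    ultimately have "u x \<le> b x - \<kappa>" using r(2)[of x] True \<rho> \<kappa>(3) by simp
    thus ?thesis using True by (simp add: v_def)
  qed (simp add: v_def)
  have "continuous_on \<Omega> v"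
  proof -
    have "continuous_on (\<Omega> \<inter> ball x0 \<rho>) (\<lambda>x. min (u x) (b x - \<kappa>))"
      by (intro continuous_intros cb continuous_on_subset[OF u(1)]) auto
    hence 1: "continuous_on (\<Omega> \<inter> ball x0 \<rho>) v"
      by (rule continuous_on_eq) (simp add: v_def dist_commute)
    have "continuous_on (\<Omega> - cball x0 (\<rho> / 2)) u" by (rule continuous_on_subset[OF u(1)]) auto
    hence 2: "continuous_on (\<Omega> - cball x0 (\<rho> / 2)) v"
      by (rule continuous_on_eq) (use out in \<open>auto simp: dist_commute\<close>)
    have "continuous_on ((\<Omega> \<inter> ball x0 \<rho>) \<union> (\<Omega> - cball x0 (\<rho> / 2))) v"
      using op by (intro continuous_on_open_Un 1 2) auto
    moreover have "(\<Omega> \<inter> ball x0 \<rho>) \<union> (\<Omega> - cball x0 (\<rho> / 2)) = \<Omega>" using \<rho> by auto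
    ultimately show ?thesis by simp
  qed
  moreover have "quad_super \<Omega> \<mu> f v"
    unfolding quad_super_def
  proof (intro ballI allI impI)
    fix x1 P e l K
    assume x1: "x1 \<in> \<Omega>" and e: "norm e = 1" and T: "\<forall>\<^sub>F x in nhds x1. v x1 + quad_test P e l K (x - x1) \<le> v x"
    show "l + \<mu> * v x1 \<le> f x1"
    proof (cases "v x1 = u x1")
      case True
      have "\<forall>\<^sub>F x in nhds x1. u x1 + quad_test P e l K (x - x1) \<le> u x"
        using T by eventually_elim (use vu True in \<open>auto intro: order_trans\<close>)
      from quad_superD[OF u(2) x1 e this] show ?thesis using True by simp
    next
      case False
      hence in\<rho>: "dist x1 x0 < \<rho>" and vb: "v x1 = b x1 - \<kappa>" by (auto simp: v_def min_def split: if_splits)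
      have "\<forall>\<^sub>F x in nhds x1. x \<in> ball x0 \<rho>"
        using in\<rho> eventually_nhds[of _ x1] by (metis dist_commute mem_ball open_ball)
      with T have "\<forall>\<^sub>F x in nhds x1. b x1 + quad_test P e l K (x - x1) \<le> b x"
      proof eventually_elim
        case (elim x)
        have "v x \<le> b x - \<kappa>" using elim by (simp add: v_def dist_commute)
        thus ?case using elim vb by linarith
      qed
      hence lc: "l \<le> c'" using e unfolding b_def by (rule quad_test_below_isotropic)
      have R: "f x0 - gap / 8 < f x1" "b x1 < u x0 + \<sigma>'" "u x0 - \<sigma>' < b x1"
        using r(2)[of x1] in\<rho> \<rho> by auto
      have "\<bar>v x1 - u x0\<bar> \<le> 2 * \<sigma>"
        using R \<kappa> \<sigma>' unfolding vb by linarith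
      hence "\<bar>\<mu> * (v x1 - u x0)\<bar> \<le> gap / 4"
        using mult_left_mono[of "\<bar>v x1 - u x0\<bar>" "2 * \<sigma>" "\<bar>\<mu>\<bar>"] \<sigma>(2) by (simp add: abs_mult)
      hence "\<mu> * v x1 \<le> \<mu> * u x0 + gap / 4"
        using abs_le_D1 by (fastforce simp: right_diff_distrib)
      moreover have "c' = c + gap / 2" by (simp add: c'_def \<eta>_def)
      ultimately show ?thesis using lc R(1) gap gap_def by linarith
    qed
  qed
  moreover have "v x0 < u x0" using \<rho> \<kappa> b0 by (simp add: v_def)
  ultimately show ?thesis using that wv vu by blast
qed

text \<open>The boundary values are enforced by a family of supersolutions, one for each boundary
  point and each \<epsilon>. The common bounds \<open>w\<close> and \<open>M\<close> give all
  competitors one semiconcavity constant.\<close>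

lemma perron:
  fixes \<Omega> :: "'a::euclidean_space set"
  assumes op: "open \<Omega>" and cv: "convex \<Omega>" and bd: "bounded \<Omega>" and ne: "\<Omega> \<noteq> {}"
    and f: "continuous_on \<Omega> f" "\<And>x. x \<in> \<Omega> \<Longrightarrow> \<bar>f x\<bar> \<le> B"
    and w: "continuous_on (closure \<Omega>) w" "quad_sub \<Omega> \<mu> f w" "\<And>x. x \<in> frontier \<Omega> \<Longrightarrow> w x = 0"
    and bar: "\<And>z \<epsilon>. z \<in> frontier \<Omega> \<Longrightarrow> \<epsilon> > 0 \<Longrightarrow> \<exists>v. continuous_on (closure \<Omega>) v \<and> quad_super \<Omega> \<mu> f v \<and>
       (\<forall>x\<in>closure \<Omega>. w x \<le> v x \<and> v x \<le> M) \<and> v z \<le> \<epsilon>"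
  obtains u where "continuous_on (closure \<Omega>) u" "quad_super \<Omega> \<mu> f u" "quad_sub \<Omega> \<mu> f u"
    "\<And>x. x \<in> frontier \<Omega> \<Longrightarrow> u x = 0"
proof -
  have sub: "\<Omega> \<subseteq> closure \<Omega>" by (rule closure_subset)
  \<comment> \<open>Continuity is demanded only inside \<Omega>, which is what
    \<open>quad_super_bump\<close> delivers for the lowered function.\<close>
  define F where "F = {v. continuous_on \<Omega> v \<and> quad_super \<Omega> \<mu> f v \<and> (\<forall>x\<in>\<Omega>. w x \<le> v x \<and> v x \<le> M)}"
  have "bounded (w ` closure \<Omega>)"
    using compact_continuous_image[OF w(1)] bd by (simp add: compact_imp_bounded)
  then obtain m where m: "\<And>x. x \<in> closure \<Omega> \<Longrightarrow> \<bar>w x\<bar> \<le> m"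
    unfolding bounded_real by blast
  have "frontier \<Omega> \<noteq> {}" using ne bd by (metis frontier_eq_empty not_bounded_UNIV)
  then obtain z0 where z0: "z0 \<in> frontier \<Omega>" by blast
  obtain v0 where "continuous_on (closure \<Omega>) v0" "quad_super \<Omega> \<mu> f v0" "\<forall>x\<in>closure \<Omega>. w x \<le> v0 x \<and> v0 x \<le> M"
    using bar[OF z0 zero_less_one] by blast
  hence "v0 \<in> F" unfolding F_def using continuous_on_subset[OF _ sub] sub by auto
  hence Fne: "F \<noteq> {}" by blast
  have Flo: "- m \<le> v x" if "v \<in> F" "x \<in> \<Omega>" for v x
    using that m[of x] sub unfolding F_def by fastforce
  have bdd: "bdd_below ((\<lambda>v. v x) ` F)" if "x \<in> \<Omega>" for x
    using Flo that by (auto intro!: bdd_belowI)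
  define C where "C = B + \<bar>\<mu>\<bar> * (\<bar>m\<bar> + \<bar>M\<bar>)"
  have conc: "concave_on \<Omega> (\<lambda>x. v x - C / 2 * (x \<bullet> x))" if v: "v \<in> F" for v
  proof (rule quad_super_concave[OF op cv])
    show "lsc_on \<Omega> v" using v by (auto simp: F_def intro: continuous_on_imp_lsc_on)
    have "quad_super \<Omega> \<mu> f v" using v by (simp add: F_def)
    thus "quad_super \<Omega> 0 (\<lambda>_. C) v"
    proof (rule quad_super_mono[OF _ order_refl])
      fix x assume x: "x \<in> \<Omega>"
      have "v x \<le> M" using v x by (simp add: F_def)
      hence "\<bar>v x\<bar> \<le> \<bar>m\<bar> + \<bar>M\<bar>" using Flo[OF v x] by linarith
      hence "\<bar>\<mu> * v x\<bar> \<le> \<bar>\<mu>\<bar> * (\<bar>m\<bar> + \<bar>M\<bar>)" unfolding abs_mult by (rule mult_left_mono) simp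
      thus "f x - \<mu> * v x \<le> C - 0 * v x" using f(2)[OF x] by (simp add: C_def)
    qed
  qed
  define u where "u = (\<lambda>x. INF v\<in>F. v x)"
  have uc: "continuous_on \<Omega> u" unfolding u_def
    by (rule INF_semiconcave_continuous[OF op cv Fne, where C = C and m = "- m"]) (use conc Flo in auto)
  have us: "quad_super \<Omega> \<mu> f u" unfolding u_def
    using Flo by (intro quad_super_INF[OF op f(1) Fne]) (auto simp: F_def)
  have le: "u x \<le> v x" if "v \<in> F" "x \<in> \<Omega>" for v x
    unfolding u_def using that by (intro cINF_lower bdd)
  have wu: "w x \<le> u x" if "x \<in> \<Omega>" for x
    unfolding u_def using that by (intro cINF_greatest[OF Fne]) (simp add: F_def)
  have uM: "u x \<le> M" if "x \<in> \<Omega>" for x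
    using le[OF \<open>v0 \<in> F\<close> that] \<open>v0 \<in> F\<close> that unfolding F_def by force
  have usub: "quad_sub \<Omega> \<mu> f u"
    unfolding quad_sub_def
  proof (intro ballI allI impI, rule ccontr)
    fix x0 p c
    assume x0: "x0 \<in> \<Omega>" and t: "\<forall>\<^sub>F x in nhds x0. u x \<le> u x0 + p \<bullet> (x - x0) + c / 2 * ((x - x0) \<bullet> (x - x0))"
      and "\<not> f x0 \<le> c + \<mu> * u x0"
    hence lt: "c + \<mu> * u x0 < f x0" by simp
    obtain v where v: "continuous_on \<Omega> v" "quad_super \<Omega> \<mu> f v" "\<And>x. x \<in> \<Omega> \<Longrightarrow> w x \<le> v x"
      "\<And>x. x \<in> \<Omega> \<Longrightarrow> v x \<le> u x" "v x0 < u x0"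
      using quad_super_bump[OF op f(1) uc us continuous_on_subset[OF w(1) sub] w(2) wu x0 t lt] by blast
    have "v \<in> F" unfolding F_def using v uM by (auto intro: order_trans)
    thus False using le[OF _ x0] v(5) by force
  qed
  \<comment> \<open>Outside \<Omega> the members of \<open>F\<close> are unconstrained, so the
    infimum is replaced there by the boundary value.\<close>
  define U where "U = (\<lambda>x. if x \<in> \<Omega> then u x else 0)"
  have disj: "x \<notin> \<Omega>" if "x \<in> frontier \<Omega>" for x
    using that op by (simp add: frontier_def interior_open)
  have "continuous_on (closure \<Omega>) U"
  proof (rule continuous_on_def[THEN iffD2], rule ballI)
    fix x assume x: "x \<in> closure \<Omega>"
    show "(U \<longlongrightarrow> U x) (at x within closure \<Omega>)"
    proof (cases "x \<in> \<Omega>")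
      case True
      have ev: "\<forall>\<^sub>F y in at x within closure \<Omega>. y \<in> \<Omega>"
        using op True eventually_at_topological by blast
      have "(u \<longlongrightarrow> u x) (at x)" using uc True op by (metis continuous_on_eq_continuous_at isCont_def)
      hence "(u \<longlongrightarrow> u x) (at x within closure \<Omega>)" using tendsto_within_subset by blast
      moreover have "\<forall>\<^sub>F y in at x within closure \<Omega>. u y = U y"
        using ev by eventually_elim (simp add: U_def)
      ultimately show ?thesis using True by (simp add: U_def filterlim_cong)
    next
      case False
      hence fr: "x \<in> frontier \<Omega>" using x op by (simp add: frontier_def interior_open)
      have Ux: "U x = 0" using False by (simp add: U_def)
      show ?thesis unfolding Ux
      proof (rule tendstoI)
        fix \<epsilon> :: real assume \<epsilon>: "\<epsilon> > 0"
        \<comment> \<open>Near a boundary point \<open>U\<close> is squeezed between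
          \<open>w\<close>, which vanishes at it, and a barrier that is at most
          \<open>\<epsilon> / 2\<close> at it.\<close>
        obtain v where v: "continuous_on (closure \<Omega>) v" "quad_super \<Omega> \<mu> f v" "\<forall>x\<in>closure \<Omega>. w x \<le> v x \<and> v x \<le> M" "v x \<le> \<epsilon> / 2"
          using bar[OF fr, of "\<epsilon> / 2"] \<epsilon> by auto
        have vF: "v \<in> F" unfolding F_def using v continuous_on_subset[OF _ sub] sub by auto
        have "(v \<longlongrightarrow> v x) (at x within closure \<Omega>)" using v(1) x by (simp add: continuous_on_def)
        hence 1: "\<forall>\<^sub>F y in at x within closure \<Omega>. v y < \<epsilon>" by (rule order_tendstoD(2)) (use v(4) \<epsilon> in simp)
        have "(w \<longlongrightarrow> w x) (at x within closure \<Omega>)" using w(1) x by (simp add: continuous_on_def)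
        hence 2: "\<forall>\<^sub>F y in at x within closure \<Omega>. - \<epsilon> < w y" by (rule order_tendstoD(1)) (use w(3)[OF fr] \<epsilon> in simp)
        show "\<forall>\<^sub>F y in at x within closure \<Omega>. dist (U y) 0 < \<epsilon>"
          using 1 2
        proof eventually_elim
          case (elim y)
          show ?case
          proof (cases "y \<in> \<Omega>")
            case True
            thus ?thesis using elim le[OF vF True] wu[OF True] by (simp add: U_def)
          qed (simp add: U_def \<epsilon>)
        qed
      qed
    qed
  qed
  moreover have "quad_super \<Omega> \<mu> f U" by (rule quad_super_cong[OF op _ us]) (simp add: U_def)
  moreover have "quad_sub \<Omega> \<mu> f U" by (rule quad_sub_cong[OF op _ usub]) (simp add: U_def)
  moreover have "U x = 0" if "x \<in> frontier \<Omega>" for x using disj[OF that] by (simp add: U_def)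
  ultimately show ?thesis using that by blast
qed

section \<open>Barriers\<close>

lemma strictly_convexD:
  "strictly_convex S \<Longrightarrow> x \<in> closure S \<Longrightarrow> y \<in> closure S \<Longrightarrow> x \<noteq> y \<Longrightarrow> 0 < t \<Longrightarrow> t < 1 \<Longrightarrow>
    (1 - t) *\<^sub>R x + t *\<^sub>R y \<in> S"
  by (simp add: strictly_convex_def)

lemma strictly_convex_imp_convex: "strictly_convex S \<Longrightarrow> convex S"
  unfolding convex_alt
proof (intro ballI allI impI)
  fix x y and t :: real
  assume S: "strictly_convex S" and x: "x \<in> S" and y: "y \<in> S" and t: "0 \<le> t \<and> t \<le> 1"
  show "(1 - t) *\<^sub>R x + t *\<^sub>R y \<in> S"
  proof (cases "x = y \<or> t = 0 \<or> t = 1")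
    case True
    have "(1 - t) *\<^sub>R y + t *\<^sub>R y = y" by (simp add: scaleR_left_distrib[symmetric])
    thus ?thesis using True x y by auto
  next
    case False
    have "x \<in> closure S" "y \<in> closure S" using x y closure_subset by auto
    thus ?thesis using False t by (intro strictly_convexD[OF S]) auto
  qed
qed

text \<open>The open ball about \<open>x\<close> of radius
  \<open>infdist x (frontier \<Omega>)\<close> stays in \<Omega>, so moving \<open>x\<close> along
  \<nu> by anything less does not cross the hyperplane that separates \<open>z\<close> from
  \<Omega>.\<close>

lemma supporting_direction:
  fixes \<Omega> :: "'a::euclidean_space set"
  assumes op: "open \<Omega>" and cv: "convex \<Omega>" and ne: "\<Omega> \<noteq> {}" and z: "z \<in> frontier \<Omega>"
  obtains \<nu> where "norm \<nu> = 1" "\<And>x. x \<in> \<Omega> \<Longrightarrow> \<nu> \<bullet> x + infdist x (frontier \<Omega>) \<le> \<nu> \<bullet> z"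
    "\<And>x. x \<in> \<Omega> \<Longrightarrow> \<nu> \<bullet> x < \<nu> \<bullet> z" "\<And>x. x \<in> closure \<Omega> \<Longrightarrow> \<nu> \<bullet> x \<le> \<nu> \<bullet> z"
proof -
  have z\<Omega>: "z \<notin> \<Omega>" using z op by (simp add: frontier_def interior_open)
  have "\<exists>a b. a \<noteq> 0 \<and> (\<forall>x\<in>\<Omega>. a \<bullet> x \<le> b) \<and> (\<forall>x\<in>{z}. b \<le> a \<bullet> x)"
    using z\<Omega> by (intro separating_hyperplane_sets cv ne) auto
  then obtain a b where ab: "a \<noteq> 0" "\<And>x. x \<in> \<Omega> \<Longrightarrow> a \<bullet> x \<le> b" "b \<le> a \<bullet> z" by blast
  define \<nu> where "\<nu> = a /\<^sub>R norm a"
  have n: "norm \<nu> = 1" using ab(1) by (simp add: \<nu>_def)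
  have nn: "\<nu> \<bullet> \<nu> = 1" using n by (simp add: dot_square_norm)
  have le: "\<nu> \<bullet> x \<le> \<nu> \<bullet> z" if "x \<in> \<Omega>" for x
    using ab(2)[OF that] ab(3) unfolding \<nu>_def by (simp add: divide_right_mono divide_inverse_commute[symmetric] mult_left_mono)
  have frne: "frontier \<Omega> \<noteq> {}" using z by blast
  have d: "\<nu> \<bullet> x + infdist x (frontier \<Omega>) \<le> \<nu> \<bullet> z" if x: "x \<in> \<Omega>" for x
  proof (rule dense_le)
    fix s assume s: "s < \<nu> \<bullet> x + infdist x (frontier \<Omega>)"
    define D where "D = infdist x (frontier \<Omega>)"
    define \<sigma> where "\<sigma> = max 0 (s - \<nu> \<bullet> x)"
    have Dp: "D > 0" unfolding D_def using x op frne
      by (intro infdist_pos_not_in_closed) (auto simp: frontier_def interior_open)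
    have \<sigma>: "0 \<le> \<sigma>" "\<sigma> < D" using s Dp by (auto simp: \<sigma>_def D_def)
    have "ball x D \<subseteq> \<Omega>"
    proof (rule ccontr)
      assume "\<not> ball x D \<subseteq> \<Omega>"
      moreover have "x \<in> ball x D \<inter> \<Omega>" using x Dp by simp
      ultimately have "ball x D \<inter> frontier \<Omega> \<noteq> {}"
        by (intro connected_Int_frontier) blast+
      then obtain y where "y \<in> frontier \<Omega>" "dist x y < D" by auto
      thus False using infdist_le[of y "frontier \<Omega>" x] by (simp add: D_def)
    qed
    hence "x + \<sigma> *\<^sub>R \<nu> \<in> \<Omega>" using \<sigma> n by (intro subsetD[of "ball x D" \<Omega>]) (auto simp: dist_norm)
    from le[OF this] have "\<nu> \<bullet> x + \<sigma> \<le> \<nu> \<bullet> z" by (simp add: inner_add_right nn)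
    thus "s \<le> \<nu> \<bullet> z" by (simp add: \<sigma>_def)
  qed
  have lt: "\<nu> \<bullet> x < \<nu> \<bullet> z" if x: "x \<in> \<Omega>" for x
  proof -
    have "infdist x (frontier \<Omega>) > 0" using x op frne
      by (intro infdist_pos_not_in_closed) (auto simp: frontier_def interior_open)
    thus ?thesis using d[OF x] by linarith
  qed
  have "closure \<Omega> \<subseteq> {x. \<nu> \<bullet> x \<le> \<nu> \<bullet> z}"
    using le by (intro closure_minimal closed_halfspace_le) auto
  thus ?thesis using that n d lt by blast
qed

text \<open>
  Near the boundary the subsolution is \<open>h(d(x))\<close> with \<open>d\<close> the distance to \<open>frontier \<Omega>\<close> and \<open>h\<close> a convex
  decreasing parabola: \<open>d\<close> lies below the distance to any supporting hyperplane, with equality at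
  \<open>x\<^sub>0\<close> for the hyperplane at the boundary point closest to \<open>x\<^sub>0\<close>.
\<close>

lemma lower_barrier:
  fixes \<Omega> :: "'a::euclidean_space set"
  assumes dim: "DIM('a) \<ge> 2" and op: "open \<Omega>" and cv: "convex \<Omega>" and bd: "bounded \<Omega>" and ne: "\<Omega> \<noteq> {}"
    and f: "\<And>x. x \<in> \<Omega> \<Longrightarrow> \<bar>f x\<bar> \<le> B"
  obtains w where "continuous_on UNIV w" "quad_sub \<Omega> \<mu> f w" "\<And>x. w x \<le> 0" "\<And>x. x \<in> frontier \<Omega> \<Longrightarrow> w x = 0"
proof -
  have B: "B \<ge> 0" using f ne by force
  obtain R where R: "\<And>x. x \<in> \<Omega> \<Longrightarrow> norm x \<le> R" using bd unfolding bounded_iff by blast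
  \<comment> \<open>Orthogonally to \<open>x\<close>, the function \<open>- \<psi>\<close> has
    second derivative \<open>k * \<psi>\<close>. After subtracting \<open>\<mu> * \<psi>\<close> at
    least \<psi> remains, and \<open>A\<close> makes \<psi> at least \<open>B\<close> on
    \<Omega>.\<close>
  define k where "k = \<bar>\<mu>\<bar> + 1"
  have k: "k > 0" by (simp add: k_def add_nonneg_pos)
  define A where "A = B * exp (k * R\<^sup>2 / 2)"
  have A: "A \<ge> 0" using B by (simp add: A_def)
  define \<psi> where "\<psi> = (\<lambda>x::'a. A * exp (- k * (x \<bullet> x) / 2))"
  have \<psi>0: "0 \<le> \<psi> x" for x using A by (simp add: \<psi>_def)
  have \<psi>A: "\<psi> x \<le> A" for x
  proof -
    have "exp (- k * (x \<bullet> x) / 2) \<le> 1" using k by simp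
    from mult_left_mono[OF this A] show ?thesis by (simp add: \<psi>_def)
  qed
  have \<psi>B: "B \<le> \<psi> x" if "x \<in> \<Omega>" for x
  proof -
    have "(norm x)\<^sup>2 \<le> R\<^sup>2" using R[OF that] by (intro power_mono) auto
    hence "k * (x \<bullet> x) \<le> k * R\<^sup>2" using k by (simp add: dot_square_norm)
    hence "1 \<le> exp (k * R\<^sup>2 / 2 + - k * (x \<bullet> x) / 2)" by simp
    hence "B * 1 \<le> B * (exp (k * R\<^sup>2 / 2) * exp (- k * (x \<bullet> x) / 2))"
      unfolding exp_add[symmetric] by (rule mult_left_mono) (rule B)
    thus ?thesis by (simp add: \<psi>_def A_def mult.assoc)
  qed
  \<comment> \<open>\<open>F'\<close> is the second derivative of the parabola \<open>h\<close> and
    dominates \<open>f - \<mu> w\<close>, as \<open>w\<close> lies between \<open>- A\<close> and 0.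
    The slope \<open>- (A + F')\<close> of \<open>h\<close> at 0 makes it decrease on [0, 1] to at
    most \<open>- A\<close>, so that \<open>- \<psi>\<close> takes over at distance 1 from the
    frontier.\<close>
  define F' where "F' = B + \<bar>\<mu>\<bar> * A"
  have F': "F' \<ge> 0" using A B by (simp add: F'_def)
  define h where "h = (\<lambda>t::real. F' / 2 * t\<^sup>2 - (A + F') * t)"
  have h1: "h 1 \<le> - A" using F' by (simp add: h_def)
  have hmono: "h t \<le> h s" if "0 \<le> s" "s \<le> t" "t \<le> 1" for s t
  proof -
    have "h s - h t = (t - s) * (A + F' * (1 - (s + t) / 2))"
      by (simp add: h_def power2_eq_square field_simps)
    moreover have "0 \<le> A + F' * (1 - (s + t) / 2)" using A F' that by (intro add_nonneg_nonneg mult_nonneg_nonneg) auto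
    ultimately show ?thesis using that by (metis diff_ge_0_iff_ge mult_nonneg_nonneg)
  qed
  have h0: "h 0 = 0" by (simp add: h_def)
  define d where "d = (\<lambda>x. infdist x (frontier \<Omega>))"
  have d0: "0 \<le> d x" for x by (simp add: d_def infdist_nonneg)
  have frne: "frontier \<Omega> \<noteq> {}" using ne bd by (metis frontier_eq_empty not_bounded_UNIV)
  define w where "w = (\<lambda>x. max (- \<psi> x) (h (min (d x) 1)))"
  have w0: "w x \<le> 0" for x
    using hmono[of 0 "min (d x) 1"] d0[of x] h0 \<psi>0[of x] by (simp add: w_def)
  have cw: "continuous_on UNIV w"
    unfolding w_def \<psi>_def h_def d_def by (intro continuous_intros) simp_all
  have wfr: "w x = 0" if "x \<in> frontier \<Omega>" for x
    using that \<psi>0[of x] by (simp add: w_def d_def h0)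
  have "quad_sub \<Omega> \<mu> f w"
    unfolding quad_sub_def
  proof (intro ballI allI impI)
    fix x0 p c
    assume x0: "x0 \<in> \<Omega>" and t: "\<forall>\<^sub>F x in nhds x0. w x \<le> w x0 + p \<bullet> (x - x0) + c / 2 * ((x - x0) \<bullet> (x - x0))"
    show "f x0 \<le> c + \<mu> * w x0"
    proof (cases "h (min (d x0) 1) \<le> - \<psi> x0")
      case True
      hence wx0: "w x0 = - \<psi> x0" by (simp add: w_def)
      \<comment> \<open>In a direction orthogonal to \<open>x0\<close> the squared norm grows by
        exactly \<open>s\<^sup>2\<close> on both sides, which makes the second difference of
        \<open>- \<psi>\<close> explicit.\<close>
      obtain y where y: "y \<noteq> 0" "orthogonal x0 y" using orthogonal_to_vector_exists[OF dim] by blast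
      define e where "e = y /\<^sub>R norm y"
      have e: "norm e = 1" "x0 \<bullet> e = 0" using y by (auto simp: e_def orthogonal_def)
      have ee: "e \<bullet> e = 1" using e by (simp add: dot_square_norm)
      obtain r where r: "r > 0" "\<And>s. \<bar>s\<bar> < r \<Longrightarrow> w (x0 + s *\<^sub>R e) + w (x0 - s *\<^sub>R e) \<le> 2 * w x0 + c * s\<^sup>2"
        using quad_above_second_difference[OF t e(1)] by blast
      have key: "k * \<psi> x0 \<le> c * (1 + k * s\<^sup>2 / 2)" if s: "0 < s" "s < r" for s
      proof -
        define a where "a = k * s\<^sup>2 / 2"
        have a: "a > 0" using k s by (simp add: a_def)
        have \<psi>s: "\<psi> (x0 + \<tau> *\<^sub>R e) = \<psi> x0 * exp (- a)" if "\<tau>\<^sup>2 = s\<^sup>2" for \<tau>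
        proof -
          have "(x0 + \<tau> *\<^sub>R e) \<bullet> (x0 + \<tau> *\<^sub>R e) = x0 \<bullet> x0 + s\<^sup>2"
            using e(2) ee that by (simp add: inner_add_left inner_add_right inner_commute power2_eq_square)
          hence "- k * ((x0 + \<tau> *\<^sub>R e) \<bullet> (x0 + \<tau> *\<^sub>R e)) / 2 = - k * (x0 \<bullet> x0) / 2 + - a"
            by (simp add: a_def field_simps)
          thus ?thesis unfolding \<psi>_def exp_add[symmetric] by (simp only: exp_add mult.assoc)
        qed
        have "- \<psi> (x0 + s *\<^sub>R e) + - \<psi> (x0 - s *\<^sub>R e) \<le> 2 * w x0 + c * s\<^sup>2"
          using r(2)[of s] s unfolding w_def by (smt (verit) max.cobounded1)
        hence 1: "2 * \<psi> x0 * (1 - exp (- a)) \<le> c * s\<^sup>2"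
          using \<psi>s[of s] \<psi>s[of "- s"] by (simp add: wx0 algebra_simps)
        \<comment> \<open>This elementary bound replaces a second-order expansion; letting
          \<open>s\<close> tend to 0 leaves \<open>k * \<psi> x0 \<le> c\<close>.\<close>
        have "exp (- a) \<le> 1 / (1 + a)"
        proof -
          have "1 + a \<le> exp a" by (rule exp_ge_add_one_self)
          hence "inverse (exp a) \<le> inverse (1 + a)" using a by (intro le_imp_inverse_le) auto
          thus ?thesis by (simp add: exp_minus inverse_eq_divide)
        qed
        moreover have "1 - 1 / (1 + a) = a / (1 + a)" using a by (simp add: field_simps)
        ultimately have "a / (1 + a) \<le> 1 - exp (- a)" by linarith
        hence "2 * \<psi> x0 * (a / (1 + a)) \<le> 2 * \<psi> x0 * (1 - exp (- a))"
          using \<psi>0[of x0] by (intro mult_left_mono) auto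
        with 1 have "2 * \<psi> x0 * (a / (1 + a)) \<le> c * s\<^sup>2" by linarith
        hence "2 * \<psi> x0 * a \<le> c * s\<^sup>2 * (1 + a)" using a by (simp add: pos_divide_le_eq)
        hence "s\<^sup>2 * (k * \<psi> x0) \<le> s\<^sup>2 * (c * (1 + a))" unfolding a_def by (simp add: algebra_simps)
        thus ?thesis using s by (simp add: a_def)
      qed
      have "((\<lambda>s. c * (1 + k * s\<^sup>2 / 2)) \<longlongrightarrow> c * (1 + k * 0\<^sup>2 / 2)) (at_right 0)"
        by (intro tendsto_intros) simp_all
      moreover have "\<forall>\<^sub>F s in at_right 0. k * \<psi> x0 \<le> c * (1 + k * s\<^sup>2 / 2)"
        unfolding eventually_at_right_field using key r(1) by blast
      ultimately have "k * \<psi> x0 \<le> c * (1 + k * 0\<^sup>2 / 2)"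
        by (rule tendsto_lowerbound) simp
      hence c: "k * \<psi> x0 \<le> c" by simp
      have "\<mu> * \<psi> x0 \<le> \<bar>\<mu>\<bar> * \<psi> x0" using \<psi>0[of x0] by (intro mult_right_mono) auto
      moreover have "k * \<psi> x0 = \<bar>\<mu>\<bar> * \<psi> x0 + \<psi> x0" by (simp add: k_def algebra_simps)
      ultimately show ?thesis using c \<psi>B[OF x0] f[OF x0] by (simp add: wx0)
    next
      case False
      hence gt: "- \<psi> x0 < h (min (d x0) 1)" by simp
      have d1: "d x0 < 1"
      proof (rule ccontr)
        assume "\<not> d x0 < 1"
        hence "h (min (d x0) 1) = h 1" by (simp add: min_def)
        thus False using gt h1 \<psi>A[of x0] by linarith
      qed
      have wx0: "w x0 = h (d x0)" using gt d1 by (simp add: w_def)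
      have "closed (frontier \<Omega>)" by simp
      then obtain z where z: "z \<in> frontier \<Omega>" "infdist x0 (frontier \<Omega>) = dist x0 z"
        using infdist_attains_inf frne by blast
      obtain \<nu> where \<nu>: "norm \<nu> = 1" "\<And>x. x \<in> \<Omega> \<Longrightarrow> \<nu> \<bullet> x + d x \<le> \<nu> \<bullet> z"
        unfolding d_def by (rule supporting_direction[OF op cv ne z(1)]) blast
      have \<nu>\<nu>: "\<nu> \<bullet> \<nu> = 1" using \<nu> by (simp add: dot_square_norm)
      have "\<nu> \<bullet> (z - x0) \<le> norm \<nu> * norm (z - x0)" by (rule norm_cauchy_schwarz)
      hence "\<nu> \<bullet> z - \<nu> \<bullet> x0 \<le> d x0" using \<nu>(1) z(2) by (simp add: d_def inner_diff_right dist_norm norm_minus_commute)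
      hence eq: "\<nu> \<bullet> z = \<nu> \<bullet> x0 + d x0" using \<nu>(2)[OF x0] by linarith
      obtain r where r: "r > 0" "\<And>s. \<bar>s\<bar> < r \<Longrightarrow> w (x0 + s *\<^sub>R \<nu>) + w (x0 - s *\<^sub>R \<nu>) \<le> 2 * w x0 + c * s\<^sup>2"
        using quad_above_second_difference[OF t \<nu>(1)] by blast
      obtain r' where r': "r' > 0" "ball x0 r' \<subseteq> \<Omega>" using op x0 open_contains_ball by blast
      \<comment> \<open>Along \<nu> the distance to the hyperplane is \<open>d x0 - s\<close>, which
        bounds \<open>d\<close> from above with equality at \<open>x0\<close>. As \<open>h\<close>
        decreases, the second difference of \<open>w\<close> is at least that of
        \<open>h\<close>.\<close>
      have lower: "h (d x0 - s) \<le> w (x0 + s *\<^sub>R \<nu>)" if "\<bar>s\<bar> < r'" "\<bar>s\<bar> < 1 - d x0" for s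
      proof -
        let ?x = "x0 + s *\<^sub>R \<nu>"
        have "?x \<in> \<Omega>" using that(1) \<nu>(1) by (intro subsetD[OF r'(2)]) (simp add: dist_norm)
        hence "d ?x \<le> d x0 - s" using \<nu>(2)[of ?x] eq by (simp add: inner_add_right \<nu>\<nu>)
        hence "h (d x0 - s) \<le> h (min (d ?x) 1)" using d0[of ?x] that(2) by (intro hmono) auto
        thus ?thesis by (simp add: w_def)
      qed
      define s where "s = min (min r r') (1 - d x0) / 2"
      have s: "0 < s" "s < r" "s < r'" "s < 1 - d x0" using r(1) r'(1) d1 by (auto simp: s_def)
      have "h (d x0 - s) + h (d x0 + s) \<le> 2 * w x0 + c * s\<^sup>2"
        using lower[of s] lower[of "- s"] r(2)[of s] s by simp
      moreover have "h (d x0 - s) + h (d x0 + s) = 2 * h (d x0) + F' * s\<^sup>2"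
        by (simp add: h_def power2_eq_square field_simps)
      ultimately have "F' * s\<^sup>2 \<le> c * s\<^sup>2" by (simp add: wx0)
      hence c: "F' \<le> c" using s by simp
      have "\<bar>w x0\<bar> \<le> A" using w0[of x0] gt \<psi>A[of x0] d1 unfolding wx0 by simp
      hence "\<bar>\<mu> * w x0\<bar> \<le> \<bar>\<mu>\<bar> * A" unfolding abs_mult by (intro mult_left_mono) auto
      thus ?thesis using c f[OF x0] unfolding F'_def by linarith
    qed
  qed
  thus ?thesis using that cw w0 wfr by blast
qed

section \<open>Supersolutions small at a boundary point\<close>

lemma quad_super_scaled_min:
  fixes \<Omega> :: "'a::euclidean_space set"
  assumes f: "\<And>x. x \<in> \<Omega> \<Longrightarrow> \<bar>f x\<bar> \<le> B" and \<phi>: "quad_super \<Omega> \<mu>' (\<lambda>_. 0) \<phi>" "\<And>x. x \<in> \<Omega> \<Longrightarrow> m \<le> \<phi> x"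
    and A: "A > 0" "B \<le> A * (\<mu>' - \<mu>) * m" and \<mu>: "\<mu> < \<mu>'"
    and M: "\<And>x. x \<in> \<Omega> \<Longrightarrow> \<bar>min (b x) (A * \<phi> x)\<bar> \<le> M"
    and b: "b = (\<lambda>x. a + p \<bullet> (x - z) + c / 2 * ((x - z) \<bullet> (x - z)))" and c: "c \<le> - B - \<bar>\<mu>\<bar> * M"
  shows "quad_super \<Omega> \<mu> f (\<lambda>x. min (b x) (A * \<phi> x))"
  unfolding quad_super_def
proof (intro ballI allI impI)
  let ?v = "\<lambda>x. min (b x) (A * \<phi> x)"
  fix x1 P e l K
  assume x1: "x1 \<in> \<Omega>" and e: "norm e = 1" and t: "\<forall>\<^sub>F x in nhds x1. ?v x1 + quad_test P e l K (x - x1) \<le> ?v x"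
  show "l + \<mu> * ?v x1 \<le> f x1"
  \<comment> \<open>The test function lies below whichever branch is active at \<open>x1\<close>.
    The very negative Hessian of \<open>b\<close> absorbs \<open>f\<close> and the zero-order term;
    for \<open>A * \<phi>\<close> the margin \<open>A * (\<mu>' - \<mu>) * m\<close> covers
    \<open>B\<close>.\<close>
  proof (cases "b x1 \<le> A * \<phi> x1")
    case True
    have "\<forall>\<^sub>F x in nhds x1. b x1 + quad_test P e l K (x - x1) \<le> b x"
      using t by eventually_elim (use True in simp)
    hence "l \<le> c" using e unfolding b by (rule quad_test_below_isotropic)
    moreover have "\<bar>\<mu> * ?v x1\<bar> \<le> \<bar>\<mu>\<bar> * M" unfolding abs_mult using M[OF x1] by (intro mult_left_mono) auto
    ultimately show ?thesis using c f[OF x1] by linarith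
  next
    case False
    hence v: "?v x1 = A * \<phi> x1" by simp
    have "\<forall>\<^sub>F x in nhds x1. \<phi> x1 + quad_test (P /\<^sub>R A) e (l / A) (K / A) (x - x1) \<le> \<phi> x"
      using t
    proof eventually_elim
      case (elim x)
      have "A * \<phi> x1 + quad_test P e l K (x - x1) \<le> A * \<phi> x" using elim unfolding v by simp
      moreover have "quad_test P e l K (x - x1) = A * quad_test (P /\<^sub>R A) e (l / A) (K / A) (x - x1)"
        using A(1) by (simp add: quad_test_def field_simps)
      ultimately have "A * (\<phi> x1 + quad_test (P /\<^sub>R A) e (l / A) (K / A) (x - x1)) \<le> A * \<phi> x"
        by (simp add: distrib_left)
      thus ?case using A(1) by simp
    qed
    from quad_superD[OF \<phi>(1) x1 e this] have "l / A + \<mu>' * \<phi> x1 \<le> 0" .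
    hence "A * (l / A + \<mu>' * \<phi> x1) \<le> 0" using A(1) by (simp add: mult_le_0_iff)
    hence "l + A * \<mu>' * \<phi> x1 \<le> 0" using A(1) by (simp add: algebra_simps)
    moreover have "A * (\<mu>' - \<mu>) * m \<le> A * (\<mu>' - \<mu>) * \<phi> x1"
      using A \<mu> \<phi>(2)[OF x1] by (intro mult_left_mono) auto
    ultimately show ?thesis using A(2) f[OF x1] unfolding v by (simp add: algebra_simps)
  qed
qed

text \<open>The barrier is capped by the fixed multiple \<open>A * \<phi>\<close>, so
  \<open>M\<close> is independent of \<open>z\<close> and \<epsilon>; only the cutting paraboloid
  depends on them.\<close>

lemma upper_barrier:
  fixes \<Omega> :: "'a::euclidean_space set"
  assumes op: "open \<Omega>" and sc: "strictly_convex \<Omega>" and bd: "bounded \<Omega>" and ne: "\<Omega> \<noteq> {}"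
    and f: "\<And>x. x \<in> \<Omega> \<Longrightarrow> \<bar>f x\<bar> \<le> B" and \<mu>: "\<mu> < \<mu>'"
    and \<phi>: "continuous_on (closure \<Omega>) \<phi>" "quad_super \<Omega> \<mu>' (\<lambda>_. 0) \<phi>" "\<And>x. x \<in> closure \<Omega> \<Longrightarrow> \<phi> x > 0"
  obtains M where "\<And>z \<epsilon>. z \<in> frontier \<Omega> \<Longrightarrow> \<epsilon> > 0 \<Longrightarrow> \<exists>v. continuous_on (closure \<Omega>) v \<and> quad_super \<Omega> \<mu> f v \<and>
       (\<forall>x\<in>closure \<Omega>. 0 \<le> v x \<and> v x \<le> M) \<and> v z \<le> \<epsilon>"
proof -
  have sub: "\<Omega> \<subseteq> closure \<Omega>" by (rule closure_subset)
  have cpt: "compact (closure \<Omega>)" "closure \<Omega> \<noteq> {}" using bd ne by auto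
  have cv: "convex \<Omega>" using sc by (rule strictly_convex_imp_convex)
  obtain xm where xm: "xm \<in> closure \<Omega>" "\<And>x. x \<in> closure \<Omega> \<Longrightarrow> \<phi> xm \<le> \<phi> x"
    using continuous_attains_inf[OF cpt \<phi>(1)] by blast
  obtain xM where xM: "xM \<in> closure \<Omega>" "\<And>x. x \<in> closure \<Omega> \<Longrightarrow> \<phi> x \<le> \<phi> xM"
    using continuous_attains_sup[OF cpt \<phi>(1)] by blast
  define m where "m = \<phi> xm"
  have m: "m > 0" "\<And>x. x \<in> closure \<Omega> \<Longrightarrow> m \<le> \<phi> x" using xm \<phi>(3) by (auto simp: m_def)
  have B: "B \<ge> 0" using f ne by force
  define A where "A = (B + 1) / ((\<mu>' - \<mu>) * m)"
  have A: "A > 0" "B \<le> A * (\<mu>' - \<mu>) * m"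
  proof -
    have pos: "(\<mu>' - \<mu>) * m > 0" using \<mu> m(1) by simp
    show "A > 0" unfolding A_def using pos B by (intro divide_pos_pos) auto
    have "A * ((\<mu>' - \<mu>) * m) = B + 1" unfolding A_def using pos by (metis nonzero_eq_divide_eq less_irrefl)
    thus "B \<le> A * (\<mu>' - \<mu>) * m" by (simp add: mult.assoc)
  qed
  define M where "M = A * \<phi> xM"
  define c where "c = B + \<bar>\<mu>\<bar> * M + 1"
  have M0: "M \<ge> 0" using A(1) \<phi>(3)[OF xM(1)] by (simp add: M_def)
  have c: "c > 0" using B M0 unfolding c_def by (intro add_nonneg_pos add_nonneg_nonneg) auto
  have "\<exists>v. continuous_on (closure \<Omega>) v \<and> quad_super \<Omega> \<mu> f v \<and> (\<forall>x\<in>closure \<Omega>. 0 \<le> v x \<and> v x \<le> M) \<and> v z \<le> \<epsilon>"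
    if z: "z \<in> frontier \<Omega>" and \<epsilon>: "\<epsilon> > 0" for z \<epsilon>
  proof -
    obtain \<nu> where \<nu>: "norm \<nu> = 1" "\<And>x. x \<in> \<Omega> \<Longrightarrow> \<nu> \<bullet> x < \<nu> \<bullet> z" "\<And>x. x \<in> closure \<Omega> \<Longrightarrow> \<nu> \<bullet> x \<le> \<nu> \<bullet> z"
      by (rule supporting_direction[OF op cv ne z]) blast
    have zc: "z \<in> closure \<Omega>" using z by (simp add: frontier_def)
    \<comment> \<open>Strict convexity puts the midpoint of \<open>x\<close> and \<open>z\<close>
      into \<Omega>, where the inequality is strict.\<close>
    have strict: "\<nu> \<bullet> x < \<nu> \<bullet> z" if x: "x \<in> closure \<Omega>" "x \<noteq> z" for x
    proof -
      have "(1 - 1/2) *\<^sub>R x + (1/2) *\<^sub>R z \<in> \<Omega>"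
        using x zc by (intro strictly_convexD[OF sc]) auto
      from \<nu>(2)[OF this] show ?thesis by (simp add: inner_add_right)
    qed
    \<comment> \<open>On \<open>S\<close> the quadratic term is not covered by \<epsilon>.
      \<open>S\<close> is compact and avoids \<open>z\<close>, so
      \<open>\<nu> \<bullet> (z - x)\<close> is bounded away from 0 on it and a finite slope
      \<open>K\<close> makes the paraboloid \<open>b\<close> nonnegative.\<close>
    define S where "S = {x \<in> closure \<Omega>. \<epsilon> \<le> c / 2 * ((x - z) \<bullet> (x - z))}"
    have "compact S"
    proof -
      have "closed {x. \<epsilon> \<le> c / 2 * ((x - z) \<bullet> (x - z))}"
        by (intro closed_Collect_le continuous_intros)
      from compact_Int_closed[OF cpt(1) this] show ?thesis unfolding S_def Collect_conj_eq by simp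
    qed
    have "\<exists>K\<ge>0. \<forall>x\<in>S. c / 2 * ((x - z) \<bullet> (x - z)) \<le> K * (\<nu> \<bullet> (z - x))"
    proof (cases "S = {}")
      case False
      let ?g = "\<lambda>x. (c / 2 * ((x - z) \<bullet> (x - z))) / (\<nu> \<bullet> (z - x))"
      have pos: "\<nu> \<bullet> (z - x) > 0" if "x \<in> S" for x
      proof -
        have "x \<noteq> z" using that \<epsilon> by (auto simp: S_def)
        thus ?thesis using strict[of x] that by (simp add: S_def inner_diff_right)
      qed
      have "continuous_on S ?g" using pos by (intro continuous_intros) force
      hence "\<exists>y\<in>S. \<forall>x\<in>S. ?g x \<le> ?g y" using \<open>compact S\<close> False by (intro continuous_attains_sup)
      then obtain y where y: "y \<in> S" "\<And>x. x \<in> S \<Longrightarrow> ?g x \<le> ?g y" by blast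
      have "?g y \<ge> 0" using pos[OF y(1)] c by simp
      moreover have "c / 2 * ((x - z) \<bullet> (x - z)) \<le> ?g y * (\<nu> \<bullet> (z - x))" if "x \<in> S" for x
        using y(2)[OF that] pos[OF that] by (simp only: pos_divide_le_eq)
      ultimately show ?thesis by blast
    qed auto
    then obtain K where K: "K \<ge> 0" "\<And>x. x \<in> S \<Longrightarrow> c / 2 * ((x - z) \<bullet> (x - z)) \<le> K * (\<nu> \<bullet> (z - x))" by blast
    define b where "b = (\<lambda>x. \<epsilon> + (- K *\<^sub>R \<nu>) \<bullet> (x - z) + (- c) / 2 * ((x - z) \<bullet> (x - z)))"
    have bK: "b x = \<epsilon> + K * (\<nu> \<bullet> (z - x)) - c / 2 * ((x - z) \<bullet> (x - z))" for x
      by (simp add: b_def inner_diff_right algebra_simps)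
    have b0: "0 \<le> b x" if x: "x \<in> closure \<Omega>" for x
    proof (cases "x \<in> S")
      case True thus ?thesis using K(2)[of x] \<epsilon> bK[of x] by linarith
    next
      case False
      have "0 \<le> K * (\<nu> \<bullet> (z - x))" using K(1) \<nu>(3)[OF x] by (simp add: inner_diff_right)
      thus ?thesis using False x bK[of x] by (simp add: S_def)
    qed
    define v where "v = (\<lambda>x. min (b x) (A * \<phi> x))"
    have v: "0 \<le> v x \<and> v x \<le> M" if x: "x \<in> closure \<Omega>" for x
    proof -
      have "A * \<phi> x \<le> M" unfolding M_def using A(1) xM(2)[OF x] by (intro mult_left_mono) auto
      moreover have "0 \<le> A * \<phi> x" using A(1) \<phi>(3)[OF x] by simp
      ultimately show ?thesis using b0[OF x] by (auto simp: v_def)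
    qed
    have "continuous_on (closure \<Omega>) v"
      unfolding v_def b_def by (intro continuous_intros \<phi>(1))
    moreover have "quad_super \<Omega> \<mu> f v" unfolding v_def
    proof (rule quad_super_scaled_min[OF f \<phi>(2) _ A \<mu> _ b_def])
      show "m \<le> \<phi> x" if "x \<in> \<Omega>" for x using m(2) sub that by blast
      show "\<bar>min (b x) (A * \<phi> x)\<bar> \<le> M" if "x \<in> \<Omega>" for x using v[of x] sub that unfolding v_def by fastforce
      show "- c \<le> - B - \<bar>\<mu>\<bar> * M" by (simp add: c_def)
    qed
    moreover have "v z \<le> \<epsilon>" by (simp add: v_def b_def)
    ultimately show ?thesis using v by blast
  qed
  thus ?thesis using that by blast
qed

section \<open>The Dirichlet problem\<close>

lemma quad_test_scaleR:
  "quad_test p e l K (c *\<^sub>R y) = quad_test (c *\<^sub>R p) e (c\<^sup>2 * l) (c\<^sup>2 * K) y"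
  by (simp add: quad_test_def power2_eq_square algebra_simps)

text \<open>Scaling the argument by \<sigma> multiplies second derivatives by \<sigma> squared; a
  test function is transported by the inverse homothety and tested against \<phi>.\<close>

lemma quad_super_homothety:
  fixes \<Omega> :: "'a::real_inner set"
  assumes \<phi>: "quad_super \<Omega> \<mu> (\<lambda>_. 0) \<phi>" and \<sigma>: "\<sigma> > 0"
    and im: "\<And>x. x \<in> \<Omega> \<Longrightarrow> a + \<sigma> *\<^sub>R (x - a) \<in> \<Omega>"
  shows "quad_super \<Omega> (\<sigma>\<^sup>2 * \<mu>) (\<lambda>_. 0) (\<lambda>x. \<phi> (a + \<sigma> *\<^sub>R (x - a)))"
  unfolding quad_super_def
proof (intro ballI allI impI)
  define T where "T = (\<lambda>x. a + \<sigma> *\<^sub>R (x - a))"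
  fix x1 p e l K
  assume x1: "x1 \<in> \<Omega>" and e: "norm e = 1"
    and "\<forall>\<^sub>F x in nhds x1. \<phi> (a + \<sigma> *\<^sub>R (x1 - a)) + quad_test p e l K (x - x1) \<le> \<phi> (a + \<sigma> *\<^sub>R (x - a))"
  then obtain r where r: "r > 0" "\<And>x. dist x x1 < r \<Longrightarrow> \<phi> (T x1) + quad_test p e l K (x - x1) \<le> \<phi> (T x)"
    unfolding eventually_nhds_metric T_def by blast
  have "\<phi> (T x1) + quad_test (inverse \<sigma> *\<^sub>R p) e ((inverse \<sigma>)\<^sup>2 * l) ((inverse \<sigma>)\<^sup>2 * K) (y - T x1) \<le> \<phi> y"
    if y: "dist y (T x1) < \<sigma> * r" for y
  proof -
    define x where "x = x1 + (y - T x1) /\<^sub>R \<sigma>"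
    have Tx: "T x = y" using \<sigma> by (simp add: x_def T_def algebra_simps)
    have "dist x x1 = dist y (T x1) / \<sigma>"
      using \<sigma> by (simp add: x_def dist_norm divide_inverse mult.commute)
    hence "dist x x1 < r" using y \<sigma> by (simp add: pos_divide_less_eq mult.commute)
    from r(2)[OF this] have "\<phi> (T x1) + quad_test p e l K ((y - T x1) /\<^sub>R \<sigma>) \<le> \<phi> y"
      unfolding Tx by (simp add: x_def)
    thus ?thesis unfolding quad_test_scaleR .
  qed
  hence "\<forall>\<^sub>F y in nhds (T x1). \<phi> (T x1) + quad_test (inverse \<sigma> *\<^sub>R p) e ((inverse \<sigma>)\<^sup>2 * l) ((inverse \<sigma>)\<^sup>2 * K) (y - T x1) \<le> \<phi> y"
    unfolding eventually_nhds_metric using \<sigma> r(1) by (intro exI[of _ "\<sigma> * r"]) auto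
  from quad_superD[OF \<phi> _ e this] have "(inverse \<sigma>)\<^sup>2 * l + \<mu> * \<phi> (T x1) \<le> 0"
    using im[OF x1] by (simp add: T_def)
  hence "\<sigma>\<^sup>2 * ((inverse \<sigma>)\<^sup>2 * l + \<mu> * \<phi> (T x1)) \<le> 0" by (intro mult_nonneg_nonpos) auto
  moreover have "\<sigma>\<^sup>2 * (inverse \<sigma>)\<^sup>2 = 1" using \<sigma> by (simp add: power_mult_distrib[symmetric])
  ultimately show "l + \<sigma>\<^sup>2 * \<mu> * \<phi> (a + \<sigma> *\<^sub>R (x1 - a)) \<le> 0"
    by (simp add: T_def distrib_left mult.assoc[symmetric])
qed

lemma quad_super_const:
  assumes "\<And>x. x \<in> \<Omega> \<Longrightarrow> \<mu> * a \<le> f x"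
  shows "quad_super \<Omega> \<mu> f (\<lambda>_. a)"
  unfolding quad_super_def
proof (intro ballI allI impI)
  fix x0 p e l K
  assume x0: "x0 \<in> \<Omega>" and e: "norm e = 1" and t: "\<forall>\<^sub>F x in nhds x0. a + quad_test p e l K (x - x0) \<le> a"
  have "\<forall>\<^sub>F x in nhds x0. (a + 0 \<bullet> (x0 - x0) + 0 / 2 * ((x0 - x0) \<bullet> (x0 - x0))) + quad_test p e l K (x - x0)
      \<le> a + 0 \<bullet> (x - x0) + 0 / 2 * ((x - x0) \<bullet> (x - x0))"
    using t by simp
  hence "l \<le> 0" using e by (rule quad_test_below_isotropic)
  thus "l + \<mu> * a \<le> f x0" using assms[OF x0] by linarith
qed

text \<open>A function from the definition of \<open>mu1_plus\<close> is controlled only inside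
  \<Omega>. By strict convexity a contraction about an interior point maps the closure into
  \<Omega>; composing with it gives continuity and positivity up to the boundary, at the price of a
  factor \<open>\<sigma>\<^sup>2\<close> on \<open>\<mu>1\<close>.\<close>

lemma strict_positive_supersolution:
  fixes \<Omega> :: "(real^'n) set"
  assumes op: "open \<Omega>" and sc: "strictly_convex \<Omega>" and ne: "\<Omega> \<noteq> {}" and \<mu>: "ereal \<mu> < mu1_plus \<Omega>"
  obtains \<mu>' \<phi> where "\<mu> < \<mu>'" "continuous_on (closure \<Omega>) \<phi>" "quad_super \<Omega> \<mu>' (\<lambda>_. 0) \<phi>"
    "\<And>x. x \<in> closure \<Omega> \<Longrightarrow> \<phi> x > 0"
proof (cases "\<mu> < 0")
  case True
  show ?thesis
    by (rule that[of 0 "\<lambda>_. 1"]) (use True in \<open>auto intro: quad_super_const\<close>)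
next
  case False
  obtain \<mu>1 \<phi> where \<phi>: "\<mu> < \<mu>1" "\<And>x. x \<in> \<Omega> \<Longrightarrow> \<phi> x > 0" "visc_supersol \<Omega> \<mu>1 (\<lambda>_. 0) \<phi>"
    using \<mu> unfolding mu1_plus_def less_Sup_iff by auto
  have qs: "quad_super \<Omega> \<mu>1 (\<lambda>_. 0) \<phi>" by (rule visc_supersol_imp_quad_super[OF op \<phi>(3)])
  have lsc: "lsc_on \<Omega> \<phi>" using \<phi>(3) by (simp add: visc_supersol_def)
  \<comment> \<open>Here \<open>\<mu>1 > 0\<close> and \<open>\<phi> > 0\<close>, so the zero-order
    term may be dropped; \<phi> is then concave and therefore continuous.\<close>
  have "quad_super \<Omega> 0 (\<lambda>_. 0) \<phi>"
    using qs order_refl by (rule quad_super_mono) (use False \<phi>(1,2) in \<open>simp add: less_imp_le\<close>)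
  hence cont: "continuous_on \<Omega> \<phi>"
    by (rule quad_super_continuous[OF op strictly_convex_imp_convex[OF sc] lsc])
  obtain a where a: "a \<in> \<Omega>" using ne by blast
  \<comment> \<open>Chosen so that \<open>\<sigma>\<^sup>2 * \<mu>1\<close> is the midpoint of \<mu>
    and \<open>\<mu>1\<close>.\<close>
  define \<sigma> where "\<sigma> = sqrt ((\<mu> / \<mu>1 + 1) / 2)"
  have q: "0 \<le> \<mu> / \<mu>1" "\<mu> / \<mu>1 < 1" using False \<phi>(1) by auto
  have \<sigma>: "0 < \<sigma>" "\<sigma> < 1" using q by (auto simp: \<sigma>_def)
  have "\<sigma>\<^sup>2 * \<mu>1 = (\<mu> + \<mu>1) / 2" using q False \<phi>(1) by (simp add: \<sigma>_def field_simps)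
  hence \<mu>': "\<mu> < \<sigma>\<^sup>2 * \<mu>1" using \<phi>(1) by simp
  have im: "a + \<sigma> *\<^sub>R (x - a) \<in> \<Omega>" if x: "x \<in> closure \<Omega>" for x
  proof (cases "x = a")
    case False
    have "a \<in> closure \<Omega>" using a closure_subset by blast
    hence "(1 - \<sigma>) *\<^sub>R a + \<sigma> *\<^sub>R x \<in> \<Omega>" using x False \<sigma> by (intro strictly_convexD[OF sc]) auto
    thus ?thesis by (simp add: algebra_simps)
  qed (simp add: a)
  show ?thesis
  proof (rule that[OF \<mu>'])
    show "continuous_on (closure \<Omega>) (\<lambda>x. \<phi> (a + \<sigma> *\<^sub>R (x - a)))"
      by (rule continuous_on_compose2[OF cont]) (use im in \<open>auto intro!: continuous_intros\<close>)
    show "quad_super \<Omega> (\<sigma>\<^sup>2 * \<mu>1) (\<lambda>_. 0) (\<lambda>x. \<phi> (a + \<sigma> *\<^sub>R (x - a)))"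
      by (rule quad_super_homothety[OF qs \<sigma>(1)]) (use im closure_subset[of \<Omega>] in auto)
    show "0 < \<phi> (a + \<sigma> *\<^sub>R (x - a))" if "x \<in> closure \<Omega>" for x using im[OF that] by (rule \<phi>(2))
  qed
qed

lemma dirichlet_sol_iff_quad:
  fixes \<Omega> :: "(real^'n) set"
  assumes "open \<Omega>"
  shows "dirichlet_sol \<Omega> \<mu> f u \<longleftrightarrow> continuous_on (closure \<Omega>) u \<and> quad_sub \<Omega> \<mu> f u \<and>
    quad_super \<Omega> \<mu> f u \<and> (\<forall>x\<in>frontier \<Omega>. u x = 0)"
proof
  assume "dirichlet_sol \<Omega> \<mu> f u"
  thus "continuous_on (closure \<Omega>) u \<and> quad_sub \<Omega> \<mu> f u \<and> quad_super \<Omega> \<mu> f u \<and> (\<forall>x\<in>frontier \<Omega>. u x = 0)"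
    unfolding dirichlet_sol_def visc_sol_def
    using visc_subsol_imp_quad_sub[OF assms] visc_supersol_imp_quad_super[OF assms] by auto
next
  assume u: "continuous_on (closure \<Omega>) u \<and> quad_sub \<Omega> \<mu> f u \<and> quad_super \<Omega> \<mu> f u \<and> (\<forall>x\<in>frontier \<Omega>. u x = 0)"
  hence "continuous_on \<Omega> u" using closure_subset continuous_on_subset by metis
  with u show "dirichlet_sol \<Omega> \<mu> f u"
    unfolding dirichlet_sol_def visc_sol_def
    by (auto intro: quad_sub_imp_visc_subsol quad_super_imp_visc_supersol assms
        continuous_on_imp_lsc_on continuous_on_imp_usc_on)
qed

theorem theorem10:
  fixes \<Omega> :: "(real^'n) set" and f :: "real^'n \<Rightarrow> real"
  assumes "CARD('n) \<ge> 2"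
    and "open \<Omega>" and "connected \<Omega>" and "\<Omega> \<noteq> {}"
    and "bounded \<Omega>" and "strictly_convex \<Omega>"
    and "continuous_on \<Omega> f" and "bounded (f ` \<Omega>)"
  shows "(\<forall>\<mu>::real. ereal \<mu> < mu1_plus \<Omega> \<longrightarrow> (\<exists>u. dirichlet_sol \<Omega> \<mu> f u))
    \<and> ((\<forall>x\<in>\<Omega>. f x \<ge> 0) \<longrightarrow> (\<forall>\<mu>::real. \<exists>u. dirichlet_sol \<Omega> \<mu> f u))
    \<and> (\<forall>\<mu>::real. ereal \<mu> < mu1_plus \<Omega> \<longrightarrow>
         (\<forall>u v. dirichlet_sol \<Omega> \<mu> f u \<and> dirichlet_sol \<Omega> \<mu> f v \<longrightarrow>
            (\<forall>x\<in>closure \<Omega>. u x = v x)))"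
proof -
  note op = assms(2) and ne = assms(4) and bd = assms(5) and sc = assms(6) and cf = assms(7)
  note cv = strictly_convex_imp_convex[OF sc]
  obtain B where B: "\<And>x. x \<in> \<Omega> \<Longrightarrow> \<bar>f x\<bar> \<le> B"
    using assms(8) unfolding bounded_real by blast
  have dim: "2 \<le> DIM(real^'n)" using assms(1) by simp
  \<comment> \<open>Existence is reduced to upper barriers: the lower barrier \<open>w\<close> is
    nonpositive, so every nonnegative upper barrier lies above it.\<close>
  have exist: "\<exists>u. dirichlet_sol \<Omega> \<mu> f u"
    if bar: "\<And>z \<epsilon>. z \<in> frontier \<Omega> \<Longrightarrow> \<epsilon> > 0 \<Longrightarrow> \<exists>v. continuous_on (closure \<Omega>) v \<and> quad_super \<Omega> \<mu> f v \<and>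
       (\<forall>x\<in>closure \<Omega>. 0 \<le> v x \<and> v x \<le> M) \<and> v z \<le> \<epsilon>" for \<mu> M
  proof -
    obtain w where w: "continuous_on UNIV w" "quad_sub \<Omega> \<mu> f w" "\<And>x. w x \<le> 0" "\<And>x. x \<in> frontier \<Omega> \<Longrightarrow> w x = 0"
      using lower_barrier[where f = f and B = B and \<mu> = \<mu>, OF dim op cv bd ne B] by blast
    have "\<exists>v. continuous_on (closure \<Omega>) v \<and> quad_super \<Omega> \<mu> f v \<and>
       (\<forall>x\<in>closure \<Omega>. w x \<le> v x \<and> v x \<le> M) \<and> v z \<le> \<epsilon>" if "z \<in> frontier \<Omega>" "\<epsilon> > 0" for z \<epsilon>
      using bar[OF that] w(3) by (meson order_trans)
    then obtain u where "continuous_on (closure \<Omega>) u" "quad_super \<Omega> \<mu> f u" "quad_sub \<Omega> \<mu> f u"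
        "\<And>x. x \<in> frontier \<Omega> \<Longrightarrow> u x = 0"
      using perron[where f = f and B = B, OF op cv bd ne cf B continuous_on_subset[OF w(1) subset_UNIV] w(2,4), of M] by blast
    thus ?thesis using dirichlet_sol_iff_quad[OF op] by blast
  qed
  have a: "\<exists>u. dirichlet_sol \<Omega> \<mu> f u" if \<mu>: "ereal \<mu> < mu1_plus \<Omega>" for \<mu>
  proof -
    obtain \<mu>' \<phi> where \<phi>: "\<mu> < \<mu>'" "continuous_on (closure \<Omega>) \<phi>" "quad_super \<Omega> \<mu>' (\<lambda>_. 0) \<phi>"
      "\<And>x. x \<in> closure \<Omega> \<Longrightarrow> \<phi> x > 0"
      using strict_positive_supersolution[OF op sc ne \<mu>] by blast
    obtain M where "\<And>z \<epsilon>. z \<in> frontier \<Omega> \<Longrightarrow> \<epsilon> > 0 \<Longrightarrow> \<exists>v. continuous_on (closure \<Omega>) v \<and>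
        quad_super \<Omega> \<mu> f v \<and> (\<forall>x\<in>closure \<Omega>. 0 \<le> v x \<and> v x \<le> M) \<and> v z \<le> \<epsilon>"
      using upper_barrier[where f = f and B = B, OF op sc bd ne B \<phi>] by blast
    thus ?thesis by (rule exist)
  qed
  \<comment> \<open>For \<open>f \<ge> 0\<close> the zero function is a supersolution for every
    \<mu> and serves as barrier at each boundary point, with \<open>M = 0\<close>.\<close>
  have b: "\<exists>u. dirichlet_sol \<Omega> \<mu> f u" if "\<forall>x\<in>\<Omega>. f x \<ge> 0" for \<mu>
    by (rule exist[of _ 0], rule exI[of _ "\<lambda>_. 0"]) (use that in \<open>auto intro: quad_super_const\<close>)
  have le: "u x \<le> v x"
    if \<mu>: "ereal \<mu> < mu1_plus \<Omega>" and u: "dirichlet_sol \<Omega> \<mu> f u" and v: "dirichlet_sol \<Omega> \<mu> f v"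
      and x: "x \<in> closure \<Omega>" for \<mu> u v x
  proof -
    obtain \<mu>' \<phi> where \<phi>: "\<mu> < \<mu>'" "continuous_on (closure \<Omega>) \<phi>" "quad_super \<Omega> \<mu>' (\<lambda>_. 0) \<phi>"
      "\<And>x. x \<in> closure \<Omega> \<Longrightarrow> \<phi> x > 0"
      using strict_positive_supersolution[OF op sc ne \<mu>] by blast
    show ?thesis
    proof (rule comparison[OF op bd cf _ _ _ _ \<phi>(2,3,4,1) _ x])
      show "continuous_on (closure \<Omega>) u" "quad_sub \<Omega> \<mu> f u"
        "continuous_on (closure \<Omega>) v" "quad_super \<Omega> \<mu> f v"
        using u v by (simp_all add: dirichlet_sol_iff_quad[OF op])
      show "u y \<le> v y" if "y \<in> frontier \<Omega>" for y
        using u v that by (simp add: dirichlet_sol_iff_quad[OF op])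
    qed
  qed
  show ?thesis
  proof (intro conjI allI impI ballI)
    fix \<mu> u v x
    assume \<mu>: "ereal \<mu> < mu1_plus \<Omega>" and x: "x \<in> closure \<Omega>"
      and "dirichlet_sol \<Omega> \<mu> f u \<and> dirichlet_sol \<Omega> \<mu> f v"
    hence uv: "dirichlet_sol \<Omega> \<mu> f u" "dirichlet_sol \<Omega> \<mu> f v" by simp_all
    show "u x = v x" by (rule order_antisym[OF le[OF \<mu> uv x] le[OF \<mu> uv(2,1) x]])
  next
    fix \<mu> assume "ereal \<mu> < mu1_plus \<Omega>"
    thus "\<exists>u. dirichlet_sol \<Omega> \<mu> f u" by (rule a)
  next
    fix \<mu> assume "\<forall>x\<in>\<Omega>. f x \<ge> 0"
    thus "\<exists>u. dirichlet_sol \<Omega> \<mu> f u" by (rule b)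
  qed
qed

end
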